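(* Let $n$ be a positive integer and let $L_n^{(\alpha)}$ denote the Laguerre polynomial. For $x>1$ and $\alpha\in\mathbb{C}$ let $A_k,B_k$ (depending on $x,\alpha$) be the two-point Taylor coefficients of $f(w)=(1-w)^{1/2-\alpha}$ at the points $w^{\pm}=1-\frac{x}{2}\pm\frac{i}{2}\xi$ (with $\xi=\sqrt{x(4-x)}$), as defined in the context, and for $k=0,1,2,\ldots$ let $$\Phi_k(x,n)=\sum_{j=0}^k\binom{k}{j}x^{k-j}L^{(1/2-2j)}_{n-k+j}(nx),\qquad \Psi_k(x,n)=\sum_{j=0}^k\binom{k}{j}x^{k-j}L^{(1/2-2j)}_{n-k+j-1}(nx).$$ Then the expansion $$L_n^{(\alpha)}(nx)=\sum_{k=0}^\infty\left[A_k\,\Phi_k(x,n)+B_k\,\Psi_k(x,n)\right]$$ is convergent, uniformly for $\alpha\in\mathbb{C}$ in compact sets and $x\ge 1+\delta$, for every $\delta>0$. Moreover, $\{\Phi_k(x,n)\}$ and $\{\Psi_k(x,n)\}$ are asymptotic sequences for large $n$, in the sense that for each $k=0,1,2,\ldots$ and fixed $x$, as $n\to\infty$, $$\Phi_k(x,n)=\mathcal{O}\!\left(n^{-\lfloor (k+1)/2\rfloor}\right)\left[\,|\Phi_0(x,n)|+|\Psi_0(x,n)|\,\right],$$ $$\Psi_k(x,n)=\mathcal{O}\!\left(n^{-\lfloor (k+1)/2\rfloor}\right)\left[\,|\Phi_0(x,n)|+|\Psi_0(x,n)|\,\right].$$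
   Context: The Laguerre polynomials are defined for all $\alpha,x\in\mathbb{C}$ by $(1-t)^{-\alpha-1}e^{-tx/(1-t)}=\sum_{n=0}^\infty L_n^{(\alpha)}(x)t^n$, $|t|<1$, i.e. $L_n^{(\alpha)}(x)=\sum_{k=0}^n(-1)^k\binom{n+\alpha}{n-k}\frac{x^k}{k!}$; $L_m^{(\alpha)}=0$ for negative integers $m$. Points $w^\pm$: $\xi=\sqrt{x(4-x)}$ with positive square root for $0<x<4$, and $\xi=i\sqrt{x(x-4)}$ (positive square root) for $x\ge 4$. The points $w^\pm$ are the zeros of $(1-w)^2+xw$, i.e. $(w-w^+)(w-w^-)=(1-w)^2+xw$; they coincide when $x=4$. The function $f(w)=(1-w)^{1/2-\alpha}$ is taken with the principal branch (equal to $1$ at $w=0$), analytic in $\mathbb{C}\setminus[1,\infty)$. Its two-point Taylor expansion at $w^\pm$ is $$f(w)=\sum_{k=0}^\infty[A_k+B_kw]\,(w-w^+)^k(w-w^-)^k,$$ where the coefficients $A_k,B_k$ (independent of $w$ and $n$) are uniquely determined by the requirement that for every $N\ge 0$ the function $\big(f(w)-\sum_{k=0}^{N-1}[A_k+B_kw](w-w^+)^k(w-w^-)^k\big)\big/\big((w-w^+)^N(w-w^-)^N\big)$ is analytic at $w^+$ and $w^-$. Equivalently, $\Phi_k(x,n)=\frac1{2\pi i}\int_\Gamma (w-w^+)^k(w-w^-)^k\frac{e^{nxw/(w-1)}}{(1-w)^{3/2}}\frac{dw}{w^{n+1}}$ and $\Psi_k(x,n)=\frac1{2\pi i}\int_\Gamma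 (w-w^+)^k(w-w^-)^k\frac{e^{nxw/(w-1)}}{(1-w)^{3/2}}\frac{dw}{w^{n}}$, with $\Gamma$ a positively oriented circle around $0$ of radius less than $1$. In particular $\Phi_0(x,n)=L_n^{(1/2)}(nx)$ and $\Psi_0(x,n)=L_{n-1}^{(1/2)}(nx)$. $\lfloor\cdot\rfloor$ is the integer part. *)

theory Defs
  imports "HOL-Complex_Analysis.Complex_Analysis" "HOL-Library.Landau_Symbols"
begin

text \<open>The degree is an integer, so that the convention \<open>L\<^sub>m = 0\<close> for \<open>m < 0\<close> can be stated.\<close>

definition laguerre :: "int \<Rightarrow> complex \<Rightarrow> complex \<Rightarrow> complex" where
  "laguerre m \<alpha> z =
     (if m < 0 then 0
      else (\<Sum>k\<le>nat m. (-1) ^ k * ((of_int m + \<alpha>) gchoose (nat m - k)) * z ^ k / fact k))"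

definition xi :: "real \<Rightarrow> complex" where
  "xi x = (if x < 4 then of_real (sqrt (x * (4 - x))) else \<i> * of_real (sqrt (x * (x - 4))))"

definition w_plus :: "real \<Rightarrow> complex" where
  "w_plus x = 1 - of_real x / 2 + \<i> / 2 * xi x"

definition w_minus :: "real \<Rightarrow> complex" where
  "w_minus x = 1 - of_real x / 2 - \<i> / 2 * xi x"

lemma w_plus_minus_zeros:
  assumes "x > 0"
  shows "(w - w_plus x) * (w - w_minus x) = (1 - w)\<^sup>2 + of_real x * w"
proof -
  have "(xi x)\<^sup>2 = of_real (x * (4 - x))"
  proof (cases "x < 4")
    case True
    then show ?thesis using assms
      by (simp add: xi_def flip: of_real_power)
  next
    case False
    then show ?thesis using assms
      by (simp add: xi_def power_mult_distrib algebra_simps flip: of_real_power)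
  qed
  moreover have "(w - w_plus x) * (w - w_minus x) = (w - 1 + of_real x / 2)\<^sup>2 + (xi x)\<^sup>2 / 4"
    by (simp add: w_plus_def w_minus_def algebra_simps power2_eq_square)
  ultimately have "(w - w_plus x) * (w - w_minus x) =
      (w - 1 + of_real x / 2)\<^sup>2 + of_real x * (4 - of_real x) / 4"
    by simp
  also have "\<dots> = (1 - w)\<^sup>2 + of_real x * w"
    by (simp add: field_simps power2_eq_square)
  finally show ?thesis .
qed

text \<open>
  \<open>A\<close>, \<open>B\<close> are the two-point Taylor coefficients of \<open>f\<close> at \<open>a\<close>, \<open>b\<close>: after subtracting
  the first \<open>N\<close> terms and dividing by \<open>(w - a)\<^sup>N (w - b)\<^sup>N\<close> one is left, up to removable
  singularities at \<open>a\<close> and \<open>b\<close>, with a function analytic at both points. The points may coincide.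
\<close>

definition two_point_taylor ::
    "(complex \<Rightarrow> complex) \<Rightarrow> complex \<Rightarrow> complex \<Rightarrow> (nat \<Rightarrow> complex) \<Rightarrow> (nat \<Rightarrow> complex) \<Rightarrow> bool" where
  "two_point_taylor f a b A B \<longleftrightarrow>
     (\<forall>N. \<exists>g. g analytic_on {a, b} \<and>
        (\<forall>c\<in>{a, b}. \<forall>\<^sub>F w in at c.
           (f w - (\<Sum>k<N. (A k + B k * w) * (w - a) ^ k * (w - b) ^ k))
             / ((w - a) ^ N * (w - b) ^ N) = g w))"

definition two_point_coeffs ::
    "(complex \<Rightarrow> complex) \<Rightarrow> complex \<Rightarrow> complex \<Rightarrow> (nat \<Rightarrow> complex) \<times> (nat \<Rightarrow> complex)" where
  "two_point_coeffs f a b = (THE AB. two_point_taylor f a b (fst AB) (snd AB))"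

text \<open>\<open>powr\<close> uses the principal logarithm, so the branch cut in \<open>w\<close> is \<open>[1, \<infinity>)\<close>.\<close>

definition coeff_A :: "complex \<Rightarrow> real \<Rightarrow> nat \<Rightarrow> complex" where
  "coeff_A \<alpha> x = fst (two_point_coeffs (\<lambda>w. (1 - w) powr (1 / 2 - \<alpha>)) (w_plus x) (w_minus x))"

definition coeff_B :: "complex \<Rightarrow> real \<Rightarrow> nat \<Rightarrow> complex" where
  "coeff_B \<alpha> x = snd (two_point_coeffs (\<lambda>w. (1 - w) powr (1 / 2 - \<alpha>)) (w_plus x) (w_minus x))"

definition Phi :: "nat \<Rightarrow> real \<Rightarrow> nat \<Rightarrow> complex" where
  "Phi k x n = (\<Sum>j\<le>k. of_nat (k choose j) * of_real x ^ (k - j) *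
     laguerre (int n - int k + int j) (1 / 2 - 2 * of_nat j) (of_nat n * of_real x))"

definition Psi :: "nat \<Rightarrow> real \<Rightarrow> nat \<Rightarrow> complex" where
  "Psi k x n = (\<Sum>j\<le>k. of_nat (k choose j) * of_real x ^ (k - j) *
     laguerre (int n - int k + int j - 1) (1 / 2 - 2 * of_nat j) (of_nat n * of_real x))"

end

theory Submission
  imports Defs
begin

text \<open>
  Put \<open>s = 1 - w\<close>, \<open>P w = (1 - w)\<^sup>2 + x w\<close> and \<open>\<beta> = 1 / 2 - \<alpha>\<close>. The equation \<open>P w = u\<close> has two
  solutions \<open>s\<^sub>1\<close>, \<open>s\<^sub>2\<close> with sum \<open>x\<close> and product \<open>x - u\<close>, and for \<open>\<bar>u\<bar> < x\<close> neither of them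
  lies on the branch cut. Hence \<open>f w = A (P w) + B (P w) w\<close>, where \<open>A\<close> and \<open>B\<close> are symmetric
  in \<open>s\<^sub>1\<close>, \<open>s\<^sub>2\<close> and therefore holomorphic in \<open>\<bar>u\<bar> < x\<close>; the \<open>A\<^sub>k\<close>, \<open>B\<^sub>k\<close> are their Taylor
  coefficients at \<open>0\<close>. On \<open>\<bar>u\<bar> \<le> \<theta> x\<close>, \<open>\<theta> < 1\<close>, both functions grow at most polynomially in \<open>x\<close>,
  whereas \<open>\<bar>P w\<bar>\<close> is close to \<open>1\<close> on the circle \<open>\<bar>w\<bar> = c / x\<close>, \<open>c\<close> small. Cauchy's inequality
  on that circle bounds the coefficient of \<open>w\<^sup>n\<close> in the remainder by
  \<open>C x\<^sup>m (\<kappa> (1 + \<delta>) / x)\<^sup>N\<close> with \<open>\<kappa> < 1\<close>, uniformly in \<open>x \<ge> 1 + \<delta>\<close>.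

  The phase \<open>x w / (w - 1) - log w\<close> has derivative \<open>- P w / (w (1 - w)\<^sup>2)\<close>, so a factor \<open>P\<close> can be
  traded for a factor \<open>1 / n\<close> by integrating by parts. Division by \<open>P\<close> turns this into a recurrence
  bounding \<open>\<bar>\<Phi>\<^sub>k\<bar> + \<bar>\<Psi>\<^sub>k\<bar>\<close> by \<open>O(1 / n)\<close> times the corresponding sums for \<open>k - 1\<close> and \<open>k - 2\<close>,
  which gives the exponents \<open>\<lfloor>(k + 1) / 2\<rfloor>\<close>.
\<close>

section \<open>Two-point Taylor coefficients\<close>

text \<open>Once all earlier coefficients agree, the two remainders for \<open>N = k + 1\<close>
  differ by \<open>(p + q * w) / ((w - a) * (w - b))\<close>. This must extend continuously to
  \<open>a\<close> and \<open>b\<close>, which forces the numerator to vanish.\<close>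

lemma two_point_taylor_unique:
  assumes AB: "two_point_taylor f a b A B" and AB': "two_point_taylor f a b A' B'"
  shows "A k = A' k \<and> B k = B' k"
proof (induction k rule: less_induct)
  case (less k)
  define S where "S A B w = (\<Sum>j<Suc k. (A j + B j * w) * (w - a) ^ j * (w - b) ^ j)"
    for A B :: "nat \<Rightarrow> complex" and w
  obtain g where g: "g analytic_on {a, b}"
    and g': "\<And>c. c \<in> {a, b} \<Longrightarrow>
      \<forall>\<^sub>F w in at c. (f w - S A B w) / ((w - a) ^ Suc k * (w - b) ^ Suc k) = g w"
    using AB unfolding two_point_taylor_def S_def by meson
  obtain h where h: "h analytic_on {a, b}"
    and h': "\<And>c. c \<in> {a, b} \<Longrightarrow>
      \<forall>\<^sub>F w in at c. (f w - S A' B' w) / ((w - a) ^ Suc k * (w - b) ^ Suc k) = h w"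
    using AB' unfolding two_point_taylor_def S_def by meson
  define p q where "p = A' k - A k" and "q = B' k - B k"
  have diff: "S A' B' w - S A B w = (p + q * w) * (w - a) ^ k * (w - b) ^ k" for w
    using less by (simp add: S_def p_def q_def algebra_simps)
  have *: "\<forall>\<^sub>F w in at c. p + q * w = (g w - h w) * ((w - a) * (w - b))" if "c \<in> {a, b}" for c
  proof -
    have "\<forall>\<^sub>F w in at c. w \<noteq> a" "\<forall>\<^sub>F w in at c. w \<noteq> b"
      using eventually_at_in_open[of "- {a} \<union> {c}" c] eventually_at_in_open[of "- {b} \<union> {c}" c]
      by (auto simp: eventually_neq_at_within)
    with g'[OF that] h'[OF that] show ?thesis
    proof eventually_elim
      case (elim w)
      define Q where "Q = (w - a) ^ k * (w - b) ^ k"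
      have "Q \<noteq> 0" using elim by (simp add: Q_def)
      have "(g w - h w) = (S A' B' w - S A B w) / ((w - a) ^ Suc k * (w - b) ^ Suc k)"
        by (simp only: elim(1,2)[symmetric] diff_divide_distrib[symmetric]) simp
      also have "\<dots> = ((p + q * w) * Q) / (Q * ((w - a) * (w - b)))"
        by (simp only: diff Q_def) (simp add: mult_ac)
      also have "\<dots> = (p + q * w) / ((w - a) * (w - b))"
        using \<open>Q \<noteq> 0\<close> by simp
      finally show ?case using elim by simp
    qed
  qed
  have lim: "((\<lambda>w. g w - h w) \<longlongrightarrow> g c - h c) (at c)" if "c \<in> {a, b}" for c
  proof -
    have "(\<lambda>w. g w - h w) analytic_on {c}"
      using g h that by (intro analytic_on_diff) (auto elim: analytic_on_subset)
    from analytic_at_imp_isCont[OF this] show ?thesis by (simp add: isCont_def)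
  qed
  have zero: "p + q * c = 0" if "c \<in> {a, b}" for c
  proof -
    have "((\<lambda>w. p + q * w) \<longlongrightarrow> (g c - h c) * ((c - a) * (c - b))) (at c)"
      using *[OF that] by (rule Lim_transform_eventually[rotated, OF eventually_mono])
         (auto intro!: tendsto_intros lim that)
    moreover have "((\<lambda>w. p + q * w) \<longlongrightarrow> p + q * c) (at c)"
      by (intro tendsto_intros)
    ultimately show ?thesis using that by (auto dest: LIM_unique)
  qed
  \<comment> \<open>Two distinct zeros kill a linear polynomial. If \<open>a = b\<close>, the
    denominator has a double zero: one factor \<open>w - a\<close> of \<open>q * (w - a)\<close> is
    cancelled before \<open>w\<close> tends to \<open>a\<close>.\<close>
  have "q = 0"
  proof (cases "a = b")
    case False
    have "q * (a - b) = (p + q * a) - (p + q * b)" by (simp add: algebra_simps)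
    then show ?thesis using zero False by simp
  next
    case True
    have "p = - q * a" using zero[of a] by (simp add: add_eq_0_iff2)
    have "\<forall>\<^sub>F w in at a. w \<noteq> a" by (simp add: eventually_neq_at_within)
    with *[OF insertI1] have "\<forall>\<^sub>F w in at a. (g w - h w) * (w - a) = q"
    proof eventually_elim
      case (elim w)
      then have "q * (w - a) = (g w - h w) * (w - a) * (w - a)"
        using True \<open>p = - q * a\<close> by (simp add: algebra_simps)
      with elim show ?case by simp
    qed
    moreover have "((\<lambda>w. (g w - h w) * (w - a)) \<longlongrightarrow> (g a - h a) * (a - a)) (at a)"
      by (intro tendsto_intros lim) simp
    ultimately have "((\<lambda>w. q) \<longlongrightarrow> (g a - h a) * (a - a)) (at a)"
      by (rule Lim_transform_eventually[rotated])
    then show ?thesis by (auto dest: LIM_unique[OF tendsto_const])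
  qed
  with zero[of a] show ?case by (simp add: p_def q_def)
qed

text \<open>\<open>T\<close> is taken as the shifted power series rather than a quotient by
  \<open>u ^ N\<close>, so it is holomorphic at 0 too.\<close>

lemma holomorphic_Taylor_tail:
  fixes F :: "complex \<Rightarrow> complex"
  assumes F: "F holomorphic_on ball 0 R" and R: "R > 0"
  obtains T where "T holomorphic_on ball 0 R"
    "\<And>u. u \<in> ball 0 R \<Longrightarrow> F u = (\<Sum>k<N. (deriv ^^ k) F 0 / fact k * u ^ k) + u ^ N * T u"
proof -
  define c where "c k = (deriv ^^ k) F 0 / fact k" for k
  have sums: "(\<lambda>k. c k * u ^ k) sums F u" if "u \<in> ball 0 R" for u
    using holomorphic_power_series[OF F that] by (simp add: c_def)
  have tail: "summable (\<lambda>k. c (k + N) * u ^ k)" if "u \<in> ball 0 R" for u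
  proof (cases "u = 0")
    case True
    then show ?thesis by simp
  next
    case False
    have "summable (\<lambda>k. c (k + N) * u ^ (k + N))"
      using sums[OF that] summable_ignore_initial_segment sums_summable by blast
    then have "summable (\<lambda>k. inverse (u ^ N) * (c (k + N) * u ^ (k + N)))"
      by (rule summable_mult)
    then show ?thesis using False by (simp add: power_add field_simps)
  qed
  define T where "T u = (\<Sum>k. c (k + N) * u ^ k)" for u
  show thesis
  proof
    show "T holomorphic_on ball 0 R"
      by (rule power_series_holomorphic[where a = "\<lambda>k. c (k + N)"])
         (use tail in \<open>simp add: T_def summable_sums\<close>)
    fix u :: complex assume u: "u \<in> ball 0 R"
    have "F u = (\<Sum>k. c (k + N) * u ^ (k + N)) + (\<Sum>k<N. c k * u ^ k)"
      using sums[OF u] suminf_split_initial_segment[of "\<lambda>k. c k * u ^ k" N] by (simp add: sums_iff)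
    also have "(\<Sum>k. c (k + N) * u ^ (k + N)) = u ^ N * T u"
      unfolding T_def by (subst suminf_mult[OF tail[OF u], symmetric]) (simp add: power_add mult_ac)
    finally show "F u = (\<Sum>k<N. (deriv ^^ k) F 0 / fact k * u ^ k) + u ^ N * T u"
      by (simp add: c_def)
  qed
qed

text \<open>Taylor tails of \<open>FA\<close> and \<open>FB\<close>, evaluated at
  \<open>(w - a) * (w - b)\<close>, provide the analytic remainders; uniqueness resolves the
  definite description. The argument covers \<open>a = b\<close> as well.\<close>

lemma two_point_coeffsI:
  assumes holo: "FA holomorphic_on ball 0 R" "FB holomorphic_on ball 0 R" and R: "R > 0"
    and f: "\<And>w. norm ((w - a) * (w - b)) < R \<Longrightarrow>
      f w = FA ((w - a) * (w - b)) + FB ((w - a) * (w - b)) * w"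
  shows "two_point_coeffs f a b =
    (\<lambda>k. (deriv ^^ k) FA 0 / fact k, \<lambda>k. (deriv ^^ k) FB 0 / fact k)"
    (is "_ = (?A, ?B)")
proof -
  have "two_point_taylor f a b ?A ?B"
    unfolding two_point_taylor_def
  proof
    fix N
    obtain TA where TA: "TA holomorphic_on ball 0 R"
      "\<And>u. u \<in> ball 0 R \<Longrightarrow> FA u = (\<Sum>k<N. ?A k * u ^ k) + u ^ N * TA u"
      using holomorphic_Taylor_tail[OF holo(1) R] by blast
    obtain TB where TB: "TB holomorphic_on ball 0 R"
      "\<And>u. u \<in> ball 0 R \<Longrightarrow> FB u = (\<Sum>k<N. ?B k * u ^ k) + u ^ N * TB u"
      using holomorphic_Taylor_tail[OF holo(2) R] by blast
    define P where "P w = (w - a) * (w - b)" for w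
    define D where "D = P -` ball 0 R"
    have "open D" unfolding D_def P_def by (intro open_vimage) (auto intro!: continuous_intros)
    have abD: "{a, b} \<subseteq> D" using R by (auto simp: D_def P_def)
    define g where "g w = TA (P w) + TB (P w) * w" for w
    have "P holomorphic_on D" unfolding P_def by (intro holomorphic_intros)
    then have "(\<lambda>w. T (P w)) holomorphic_on D" if "T holomorphic_on ball 0 R" for T
      using holomorphic_on_compose_gen[of P D T "ball 0 R"] that by (auto simp: D_def o_def)
    then have "g holomorphic_on D" using TA TB unfolding g_def by (intro holomorphic_intros) auto
    then have "g analytic_on {a, b}"
      using \<open>open D\<close> abD analytic_on_open analytic_on_subset by blast
    moreover have "\<forall>\<^sub>F w in at c. (f w - (\<Sum>k<N. (?A k + ?B k * w) * (w - a) ^ k * (w - b) ^ k))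
           / ((w - a) ^ N * (w - b) ^ N) = g w" if "c \<in> {a, b}" for c
    proof -
      have "\<forall>\<^sub>F w in at c. w \<noteq> a" "\<forall>\<^sub>F w in at c. w \<noteq> b" "\<forall>\<^sub>F w in at c. w \<in> D"
        using abD that \<open>open D\<close>
        by (auto simp: eventually_neq_at_within intro!: eventually_at_in_open')
      then show ?thesis
      proof eventually_elim
        case (elim w)
        then have u: "P w \<in> ball 0 R" and "P w ^ N \<noteq> 0" by (auto simp: D_def P_def)
        have "f w = FA (P w) + FB (P w) * w"
          using f[of w] u by (simp add: P_def)
        also have "\<dots> = (\<Sum>k<N. (?A k + ?B k * w) * P w ^ k) + P w ^ N * g w"
          unfolding TA(2)[OF u] TB(2)[OF u] g_def
          by (simp add: algebra_simps sum.distrib sum_distrib_left)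
        finally have "(f w - (\<Sum>k<N. (?A k + ?B k * w) * P w ^ k)) / P w ^ N = g w"
          using \<open>P w ^ N \<noteq> 0\<close> by simp
        then show ?case by (simp add: P_def power_mult_distrib mult.assoc)
      qed
    qed
    ultimately show "\<exists>g. g analytic_on {a, b} \<and> (\<forall>c\<in>{a, b}. \<forall>\<^sub>F w in at c.
           (f w - (\<Sum>k<N. (?A k + ?B k * w) * (w - a) ^ k * (w - b) ^ k))
             / ((w - a) ^ N * (w - b) ^ N) = g w)"
      by blast
  qed
  then show ?thesis
    unfolding two_point_coeffs_def
    by (intro the_equality) (auto simp: prod_eq_iff fun_eq_iff dest: two_point_taylor_unique)
qed

section \<open>The generating function of the Laguerre polynomials\<close>

lemma gbinomial_neg_one_power:
  "(- 1) ^ i * ((\<gamma> - of_nat k) gchoose i) = (of_nat (i + k) - \<gamma> - 1) gchoose i"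
  for \<gamma> :: complex
  by (subst gbinomial_negated_upper) (simp add: algebra_simps flip: power_mult_distrib)

lemma has_fps_expansion_one_minus_powr:
  "(\<lambda>w::complex. (1 - w) powr \<gamma>) has_fps_expansion (fps_binomial \<gamma> oo (- fps_X))"
proof -
  have "(\<lambda>w::complex. - w) has_fps_expansion - fps_X"
    by (intro fps_expansion_intros)
  from has_fps_expansion_compose[OF has_fps_expansion_binomial_complex[of \<gamma>] this]
  show ?thesis by (simp add: o_def)
qed

text \<open>Coefficients of \<open>(1 - w)\<^sup>\<gamma> exp (- z w / (1 - w))\<close>.\<close>

definition laguerre_fps :: "complex \<Rightarrow> complex \<Rightarrow> complex fps" where
  "laguerre_fps \<gamma> z = Abs_fps (\<lambda>m. laguerre (int m) (- \<gamma> - 1) z)"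

text \<open>Because \<open>(w / (1 - w))^k (1 - w)^\<gamma> = w^k (1 - w)^(\<gamma> - k)\<close>,
  expanding the exponential leaves only binomial series.\<close>

lemma has_fps_expansion_laguerre:
  "(\<lambda>w. (1 - w) powr \<gamma> * exp (- z * w / (1 - w))) has_fps_expansion laguerre_fps \<gamma> z"
proof -
  define b :: "complex fps" where "b = fps_X * inverse (1 - fps_X)"
  define c where "c = fps_binomial \<gamma> oo (- fps_X :: complex fps)"
  have b: "(\<lambda>w. w / (1 - w)) has_fps_expansion b"
    unfolding divide_inverse b_def by (intro fps_expansion_intros) simp
  have "((\<lambda>w. exp (- z * w)) \<circ> (\<lambda>w. w / (1 - w))) has_fps_expansion (fps_exp (- z) oo b)"
    by (intro has_fps_expansion_compose b has_fps_expansion_exp) (simp add: b_def)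
  then have *: "(\<lambda>w. (1 - w) powr \<gamma> * exp (- z * w / (1 - w))) has_fps_expansion c * (fps_exp (- z) oo b)"
    unfolding c_def by (intro fps_expansion_intros has_fps_expansion_one_minus_powr) (simp add: o_def)
  have bk: "b ^ k * c = fps_X ^ k * (fps_binomial (\<gamma> - of_nat k) oo (- fps_X))" for k
  proof -
    have "(1 - fps_X) ^ k * inverse (1 - fps_X) ^ k = (1 :: complex fps)"
      by (simp add: inverse_mult_eq_1' flip: power_mult_distrib)
    moreover have "c = (fps_binomial (of_nat k) oo (- fps_X)) * (fps_binomial (\<gamma> - of_nat k) oo (- fps_X))"
      unfolding c_def by (subst fps_compose_mult_distrib[symmetric]) (simp_all flip: fps_binomial_add_mult)
    moreover have "fps_binomial (of_nat k) oo (- fps_X) = (1 - fps_X :: complex fps) ^ k"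
      by (simp add: fps_binomial_of_nat fps_compose_add_distrib flip: fps_compose_power)
    ultimately show ?thesis
      by (simp add: b_def power_mult_distrib mult_ac)
  qed
  have "(c * (fps_exp (- z) oo b)) $ m = laguerre_fps \<gamma> z $ m" for m
  proof -
    \<comment> \<open>\<open>b ^ k\<close> has no terms below degree \<open>k\<close>, so the sum
      may run to the common bound \<open>m\<close>; the two sums can then be interchanged.\<close>
    have "(fps_exp (- z) oo b) $ i = (\<Sum>k\<le>m. (- z) ^ k / fact k * (b ^ k $ i))" if "i \<le> m" for i
    proof -
      have "b ^ k $ i = 0" if "i < k" for k
        using that unfolding b_def power_mult_distrib by (simp add: fps_X_power_mult_nth)
      then show ?thesis
        unfolding fps_compose_nth using that
        by (intro sum.mono_neutral_cong_left) auto
    qed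
    then have "(c * (fps_exp (- z) oo b)) $ m =
        (\<Sum>j\<le>m. (\<Sum>k\<le>m. (- z) ^ k / fact k * (b ^ k $ j)) * c $ (m - j))"
      by (subst mult.commute) (auto simp: fps_mult_nth atMost_atLeast0 intro!: sum.cong)
    also have "\<dots> = (\<Sum>k\<le>m. (- z) ^ k / fact k * (b ^ k * c) $ m)"
      unfolding sum_distrib_right
      by (subst sum.swap) (simp only: fps_mult_nth atMost_atLeast0 sum_distrib_left mult.assoc)
    also have "\<dots> = (\<Sum>k\<le>m. (-1) ^ k * ((of_nat m - \<gamma> - 1) gchoose (m - k)) * z ^ k / fact k)"
      unfolding bk by (intro sum.cong refl)
        (simp add: fps_X_power_mult_nth fps_compose_uminus' gbinomial_neg_one_power power_minus[of z])
    finally show ?thesis by (simp add: laguerre_fps_def laguerre_def algebra_simps)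
  qed
  then have "c * (fps_exp (- z) oo b) = laguerre_fps \<gamma> z" by (rule fps_ext)
  with * show ?thesis by simp
qed

section \<open>Identities of formal series, proved by comparing functions near 0\<close>

lemma has_fps_expansion_unique:
  fixes f :: "complex \<Rightarrow> complex"
  shows "f has_fps_expansion F \<Longrightarrow> f has_fps_expansion G \<Longrightarrow> F = G"
  by (simp add: fps_eq_iff fps_nth_fps_expansion)

text \<open>Raising the exponent of \<open>1 - w\<close> by \<open>k\<close> lowers the Laguerre
  parameter by \<open>k\<close>. With \<open>k = 2 j\<close> this accounts for the parameters
  \<open>1 / 2 - 2 j\<close> in \<open>Phi\<close> and \<open>Psi\<close>.\<close>

lemma laguerre_fps_shift:
  "(1 - fps_X) ^ k * laguerre_fps \<gamma> z = laguerre_fps (\<gamma> + of_nat k) z"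
proof (rule has_fps_expansion_unique)
  show "(\<lambda>w. (1 - w) ^ k * ((1 - w) powr \<gamma> * exp (- z * w / (1 - w)))) has_fps_expansion
     (1 - fps_X) ^ k * laguerre_fps \<gamma> z"
    by (intro fps_expansion_intros has_fps_expansion_laguerre)
  have "\<forall>\<^sub>F w in nhds 0. w \<in> - {1::complex}"
    by (intro eventually_nhds_in_open) auto
  then have "\<forall>\<^sub>F w in nhds 0. (1 - w) ^ k * ((1 - w) powr \<gamma> * exp (- z * w / (1 - w))) =
    (1 - w) powr (\<gamma> + of_nat k) * exp (- z * w / (1 - w))"
    by eventually_elim (auto simp: powr_add powr_nat)
  from has_fps_expansion_cong[OF this refl] show "(\<lambda>w. (1 - w) ^ k * ((1 - w) powr \<gamma> * exp (- z * w / (1 - w)))) has_fps_expansion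
     laguerre_fps (\<gamma> + of_nat k) z"
    using has_fps_expansion_laguerre by simp
qed

text \<open>The logarithmic derivative of the generating function is
  \<open>- \<gamma> / (1 - w) - z / (1 - w)^2\<close>; the factor \<open>(1 - w)^2\<close> clears
  the denominators.\<close>

lemma laguerre_fps_deriv:
  "(1 - fps_X)\<^sup>2 * fps_deriv (laguerre_fps \<gamma> z) =
     - (fps_const \<gamma> * (1 - fps_X) + fps_const z) * laguerre_fps \<gamma> z"
proof (rule has_fps_expansion_unique)
  let ?f = "\<lambda>w. (1 - w) powr \<gamma> * exp (- z * w / (1 - w))"
  show "(\<lambda>w. (1 - w) ^ 2 * deriv ?f w) has_fps_expansion
     (1 - fps_X) ^ 2 * fps_deriv (laguerre_fps \<gamma> z)"
    by (intro fps_expansion_intros has_fps_expansion_laguerre)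
  have "\<forall>\<^sub>F w in nhds 0. w \<in> ball 0 (1::real)"
    by (intro eventually_nhds_in_open) auto
  then have "\<forall>\<^sub>F w::complex in nhds 0. (1 - w) ^ 2 * deriv ?f w =
     - (\<gamma> * (1 - w) + z) * ?f w"
  proof eventually_elim
    case (elim w)
    have "Re w < 1" using elim complex_Re_le_cmod[of w] by simp
    then have nz: "1 - w \<noteq> 0" "1 - w \<notin> \<real>\<^sub>\<le>\<^sub>0" by (auto simp: complex_nonpos_Reals_iff)
    have "(?f has_field_derivative
        - \<gamma> * (1 - w) powr (\<gamma> - 1) * exp (- z * w / (1 - w)) +
        (1 - w) powr \<gamma> * (exp (- z * w / (1 - w)) * (- z / (1 - w) ^ 2))) (at w)"
      using nz by (auto intro!: derivative_eq_intros) (simp add: field_simps power2_eq_square)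
    then have "deriv ?f w = - \<gamma> * (1 - w) powr (\<gamma> - 1) * exp (- z * w / (1 - w)) +
        (1 - w) powr \<gamma> * (exp (- z * w / (1 - w)) * (- z / (1 - w) ^ 2))"
      by (rule DERIV_imp_deriv)
    also have "(1 - w) powr (\<gamma> - 1) = (1 - w) powr \<gamma> / (1 - w)"
      using nz by (simp add: powr_diff)
    finally have *: "deriv ?f w = - \<gamma> * ((1 - w) powr \<gamma> / (1 - w)) * exp (- z * w / (1 - w)) +
        (1 - w) powr \<gamma> * (exp (- z * w / (1 - w)) * (- z / (1 - w) ^ 2))" .
    have "v ^ 2 * (- \<gamma> * (p / v) * e + p * (e * (- z / v ^ 2))) = - (\<gamma> * v + z) * (p * e)"
      if "v \<noteq> 0" for v p e :: complex
      using that by (simp add: field_simps power2_eq_square)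
    from this[OF nz(1)] show ?case unfolding * .
  qed
  note * = has_fps_expansion_cong[OF this refl]
  show "(\<lambda>w. (1 - w) ^ 2 * deriv ?f w) has_fps_expansion
     - (fps_const \<gamma> * (1 - fps_X) + fps_const z) * laguerre_fps \<gamma> z"
    by (subst *) (intro fps_expansion_intros has_fps_expansion_laguerre)
qed

section \<open>Integration by parts and the asymptotic order\<close>

text \<open>Kept as a polynomial, so that degrees and division with remainder are available.\<close>

definition saddle_poly :: "real \<Rightarrow> complex poly" where
  "saddle_poly x = [:1, of_real x - 2, 1:]"

lemma poly_saddle_poly: "poly (saddle_poly x) w = (1 - w)\<^sup>2 + of_real x * w"
  by (simp add: saddle_poly_def algebra_simps power2_eq_square)

lemma fps_of_poly_saddle_poly:
  "fps_of_poly (saddle_poly x) = (1 - fps_X)\<^sup>2 + fps_const (of_real x) * fps_X"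
proof -
  have "saddle_poly x = [:1, -1:]\<^sup>2 + [:of_real x:] * [:0, 1:]"
    by (simp add: saddle_poly_def power2_eq_square)
  then show ?thesis
    by (simp add: fps_of_poly_add fps_of_poly_mult fps_of_poly_power fps_of_poly_linear' fps_of_poly_const fps_of_poly_linear)
qed

text \<open>Binomial theorem for \<open>((1 - w)^2 + x w)^k\<close>: the factor
  \<open>w^(k - j)\<close> shifts the degree, \<open>(1 - w)^(2 j)\<close> the parameter.\<close>

lemma saddle_poly_power_laguerre_fps_nth:
  "(fps_of_poly (saddle_poly x ^ k) * laguerre_fps (- (3 / 2)) z) $ m =
     (\<Sum>j\<le>k. of_nat (k choose j) * of_real x ^ (k - j) *
       laguerre (int m - int k + int j) (1 / 2 - 2 * of_nat j) z)"
proof -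
  have "fps_of_poly (saddle_poly x ^ k) * laguerre_fps (- (3 / 2)) z =
    (\<Sum>j\<le>k. fps_const (of_nat (k choose j) * of_real x ^ (k - j)) *
       (fps_X ^ (k - j) * ((1 - fps_X) ^ (2 * j) * laguerre_fps (- (3 / 2)) z)))"
  proof -
    have "(v\<^sup>2 + c * X) ^ k * L = (\<Sum>j\<le>k. of_nat (k choose j) * c ^ (k - j) * (X ^ (k - j) * (v ^ (2 * j) * L)))"
      for v X c L :: "complex fps"
      unfolding binomial_ring sum_distrib_right
      by (intro sum.cong refl) (simp add: power_mult_distrib mult_ac flip: power_mult)
    then show ?thesis
      unfolding fps_of_poly_power fps_of_poly_saddle_poly
      by (simp add: fps_of_nat[symmetric] flip: fps_const_power fps_const_mult)
  qed
  moreover have "(fps_X ^ (k - j) * laguerre_fps (2 * of_nat j - 3 / 2) z) $ m =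
      laguerre (int m - int k + int j) (1 / 2 - 2 * of_nat j) z" if "j \<le> k" for j
  \<comment> \<open>Here the degree is negative, and the convention for \<open>laguerre\<close>
    matches the missing coefficient.\<close>
  proof (cases "m < k - j")
    case True
    then show ?thesis by (simp add: fps_X_power_mult_nth laguerre_def)
  next
    case False
    then have eq: "int m - int k + int j = int (m - (k - j))" using that by simp
    show ?thesis unfolding eq using False by (simp add: fps_X_power_mult_nth laguerre_fps_def)
  qed
  ultimately show ?thesis
    by (simp add: laguerre_fps_shift fps_sum_nth)
qed

text \<open>The contour integral of
  \<open>p w * exp (n x w / (w - 1)) * (1 - w)^(-3/2) / w^(n + 1)\<close> around 0, divided by
  \<open>2 \<pi> i\<close>, in algebraic form.\<close>

definition saddle_coeff :: "real \<Rightarrow> nat \<Rightarrow> complex poly \<Rightarrow> complex" where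
  "saddle_coeff x n p = (fps_of_poly p * laguerre_fps (- (3 / 2)) (of_nat n * of_real x)) $ n"

lemma Phi_eq_saddle_coeff: "Phi k x n = saddle_coeff x n (saddle_poly x ^ k)"
  by (simp add: Phi_def saddle_coeff_def saddle_poly_power_laguerre_fps_nth)

lemma Psi_eq_saddle_coeff: "Psi k x n = saddle_coeff x n (saddle_poly x ^ k * [:0, 1:])"
proof -
  have "saddle_coeff x n (saddle_poly x ^ k * [:0, 1:]) =
    (fps_X * (fps_of_poly (saddle_poly x ^ k) * laguerre_fps (- (3 / 2)) (of_nat n * of_real x))) $ n"
    by (simp only: saddle_coeff_def fps_of_poly_mult fps_of_poly_fps_X mult_ac)
  also have "\<dots> = Psi k x n"
    unfolding fps_X_mult_nth
    \<comment> \<open>For \<open>n = 0\<close> both sides vanish, since all degrees in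
      \<open>Psi\<close> are then negative.\<close>
    by (cases n)
       (simp_all add: saddle_poly_power_laguerre_fps_nth Psi_def laguerre_def algebra_simps)
  finally show ?thesis ..
qed

lemma saddle_coeff_add: "saddle_coeff x n (p + q) = saddle_coeff x n p + saddle_coeff x n q"
  by (simp add: saddle_coeff_def fps_of_poly_add algebra_simps)

lemma saddle_coeff_smult: "saddle_coeff x n (smult c p) = c * saddle_coeff x n p"
  by (simp add: saddle_coeff_def fps_of_poly_smult mult.assoc)

text \<open>Integration by parts: extracting the coefficient of \<open>w\<^sup>n\<close> in \<open>w G' = n G\<close>.\<close>

lemma saddle_coeff_mult_saddle_poly:
  "of_nat n * saddle_coeff x n (saddle_poly x * q) =
     saddle_coeff x n ([:0, 1:] * (smult (- 1 / 2) ([:1, -1:] * q) + [:1, -1:]\<^sup>2 * pderiv q))"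
proof -
  define L where "L = laguerre_fps (- (3 / 2)) (of_nat n * of_real x)"
  define Q where "Q = fps_of_poly q"
  define v :: "complex fps" where "v = 1 - fps_X"
  define z where "z = fps_const (of_nat n * of_real x :: complex)"
  define h where "h = fps_const (- (3 / 2) :: complex)"
  have v': "fps_deriv v = - 1" by (simp add: v_def)
  have L': "v\<^sup>2 * fps_deriv L = - (h * v + z) * L"
    unfolding L_def v_def z_def h_def by (rule laguerre_fps_deriv)
  have "fps_deriv (v\<^sup>2 * Q * L) = - 2 * v * Q * L + v\<^sup>2 * fps_deriv Q * L + Q * (v\<^sup>2 * fps_deriv L)"
    by (simp add: v' power2_eq_square algebra_simps)
  then have "fps_deriv (v\<^sup>2 * Q * L) = - 2 * v * Q * L + v\<^sup>2 * fps_deriv Q * L - Q * (h * v + z) * L"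
    unfolding L' by (simp add: algebra_simps)
  \<comment> \<open>\<open>- 2\<close> comes from differentiating \<open>v\<^sup>2\<close>, and
    \<open>- h = 3 / 2\<close> from the exponent of the kernel.\<close>
  moreover have k: "fps_const (- 1 / 2) = - 2 - h"
    by (simp add: h_def numeral_fps_const)
  ultimately have "fps_deriv (v\<^sup>2 * Q * L) =
      (fps_const (- 1 / 2) * (v * Q) + v\<^sup>2 * fps_deriv Q) * L - z * Q * L"
    unfolding k by (simp only: algebra_simps)
  then have "fps_deriv (v\<^sup>2 * Q * L) + z * Q * L =
      (fps_const (- 1 / 2) * (v * Q) + v\<^sup>2 * fps_deriv Q) * L"
    by (simp only: diff_add_cancel)
  moreover have "fps_X * fps_deriv (v\<^sup>2 * Q * L) + z * (fps_X * Q * L) =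
      fps_X * (fps_deriv (v\<^sup>2 * Q * L) + z * Q * L)"
    by (simp only: distrib_left mult_ac)
  ultimately have "fps_X * fps_deriv (v\<^sup>2 * Q * L) + z * (fps_X * Q * L) =
      fps_X * (fps_const (- 1 / 2) * (v * Q) + v\<^sup>2 * fps_deriv Q) * L"
    by (simp only: mult.assoc)
  then have "(fps_X * fps_deriv (v\<^sup>2 * Q * L) + z * (fps_X * Q * L)) $ n =
      (fps_X * (fps_const (- 1 / 2) * (v * Q) + v\<^sup>2 * fps_deriv Q) * L) $ n"
    by simp
  moreover have F: "(fps_X * fps_deriv F) $ n = of_nat n * F $ n" for F :: "complex fps"
    by (cases n) simp_all
  \<comment> \<open>As \<open>z = n x\<close>, both terms carry the factor \<open>n\<close>, and
    \<open>v\<^sup>2 + x w\<close> is the saddle polynomial.\<close>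
  have "(fps_X * fps_deriv (v\<^sup>2 * Q * L) + z * (fps_X * Q * L)) $ n =
     of_nat n * ((v\<^sup>2 * Q * L) $ n + of_real x * (fps_X * Q * L) $ n)"
    unfolding fps_add_nth F z_def fps_mult_left_const_nth by (simp only: algebra_simps)
  also have "(v\<^sup>2 * Q * L) $ n + of_real x * (fps_X * Q * L) $ n = (fps_of_poly (saddle_poly x * q) * L) $ n"
  proof -
    have "fps_of_poly (saddle_poly x * q) * L = v\<^sup>2 * Q * L + fps_const (of_real x) * (fps_X * Q * L)"
      by (simp only: fps_of_poly_mult fps_of_poly_saddle_poly v_def Q_def distrib_right mult.assoc)
    then show ?thesis by (simp only: fps_add_nth fps_mult_left_const_nth)
  qed
  finally have "of_nat n * (fps_of_poly (saddle_poly x * q) * L) $ n =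
      (fps_X * (fps_const (- 1 / 2) * (v * Q) + v\<^sup>2 * fps_deriv Q) * L) $ n" by simp
  moreover have "fps_of_poly [:1, -1:] = v" by (simp add: v_def fps_of_poly_pCons)
  ultimately show ?thesis
    unfolding saddle_coeff_def L_def[symmetric]
    by (simp only: Q_def fps_of_poly_mult fps_of_poly_add fps_of_poly_smult fps_of_poly_power
        fps_of_poly_pderiv fps_of_poly_fps_X)
qed

section \<open>A recurrence in \<open>k\<close> and the resulting orders in \<open>n\<close>\<close>

definition saddle_norm :: "real \<Rightarrow> nat \<Rightarrow> nat \<Rightarrow> real" where
  "saddle_norm x k n = norm (Phi k x n) + norm (Psi k x n)"

lemma saddle_norm_nonneg [simp]: "saddle_norm x k n \<ge> 0"
  by (simp add: saddle_norm_def)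

text \<open>Repeated division by \<open>P = saddle_poly x\<close> writes \<open>p\<close> as a sum
  of terms \<open>P ^ j * (a + b * w)\<close>, and these yield \<open>Phi\<close> and
  \<open>Psi\<close>. That \<open>C\<close> is independent of \<open>k\<close> lets the quotient be
  treated at level \<open>Suc k\<close>.\<close>

lemma saddle_coeff_bound:
  assumes "degree p \<le> Suc (2 * d)"
  shows "\<exists>C\<ge>0. \<forall>k n. norm (saddle_coeff x n (saddle_poly x ^ k * p)) \<le>
    C * (\<Sum>j\<le>d. saddle_norm x (k + j) n)"
  using assms
proof (induction d arbitrary: p)
  case (0 p)
  define a b where "a = coeff p 0" and "b = coeff p 1"
  have p: "p = [:a:] + smult b [:0, 1:]"
    using 0 by (auto simp: poly_eq_iff a_def b_def coeff_pCons coeff_eq_0 split: nat.split)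
  have "norm (saddle_coeff x n (saddle_poly x ^ k * p)) \<le> (norm a + norm b) * saddle_norm x k n" for k n
  proof -
    have "saddle_poly x ^ k * p = smult a (saddle_poly x ^ k) + smult b (saddle_poly x ^ k * [:0, 1:])"
      by (simp add: p algebra_simps)
    then have "saddle_coeff x n (saddle_poly x ^ k * p) = a * Phi k x n + b * Psi k x n"
      by (simp only: saddle_coeff_add saddle_coeff_smult Phi_eq_saddle_coeff Psi_eq_saddle_coeff)
    also have "norm \<dots> \<le> norm a * norm (Phi k x n) + norm b * norm (Psi k x n)"
      by (metis norm_mult norm_triangle_ineq)
    also have "\<dots> \<le> (norm a + norm b) * saddle_norm x k n"
      by (simp add: saddle_norm_def algebra_simps)
    finally show ?thesis .
  qed
  then show ?case by (intro exI[of _ "norm a + norm b"]) auto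
next
  case (Suc d p)
  define s r where "s = p div saddle_poly x" and "r = p mod saddle_poly x"
  have deg: "degree (saddle_poly x) = 2" by (simp add: saddle_poly_def)
  then have "saddle_poly x \<noteq> 0" by auto
  with deg have r: "degree r \<le> 1"
    using degree_mod_less[of "saddle_poly x" p] by (auto simp: r_def)
  have "degree s \<le> Suc (2 * d)"
  proof (cases "s = 0")
    case False
    then have "2 + degree s = degree (saddle_poly x * s)"
      using \<open>saddle_poly x \<noteq> 0\<close> by (simp add: degree_mult_eq deg)
    also have "saddle_poly x * s = p - r"
      by (simp add: s_def r_def minus_mod_eq_mult_div)
    also have "degree (p - r) \<le> Suc (2 * Suc d)"
      using Suc.prems r by (intro degree_diff_le) auto
    finally show ?thesis by simp
  qed simp
  with r obtain C C' where C: "C \<ge> 0" "\<And>k n. norm (saddle_coeff x n (saddle_poly x ^ k * s)) \<le>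
       C * (\<Sum>j\<le>d. saddle_norm x (k + j) n)"
    and C': "C' \<ge> 0" "\<And>k n. norm (saddle_coeff x n (saddle_poly x ^ k * r)) \<le>
       C' * (\<Sum>j\<le>d. saddle_norm x (k + j) n)"
    using Suc.IH[of s] Suc.IH[of r] by fastforce
  have "norm (saddle_coeff x n (saddle_poly x ^ k * p)) \<le>
      (C + C') * (\<Sum>j\<le>Suc d. saddle_norm x (k + j) n)" for k n
  proof -
    have "p = saddle_poly x * s + r" by (simp add: s_def r_def)
    then have "saddle_poly x ^ k * p = saddle_poly x ^ Suc k * s + saddle_poly x ^ k * r"
      by (simp only: power_Suc distrib_left mult.assoc mult.left_commute)
    then have "norm (saddle_coeff x n (saddle_poly x ^ k * p)) \<le>
        norm (saddle_coeff x n (saddle_poly x ^ Suc k * s)) + norm (saddle_coeff x n (saddle_poly x ^ k * r))"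
      by (simp only: saddle_coeff_add norm_triangle_ineq)
    also have "\<dots> \<le> C * (\<Sum>j\<le>d. saddle_norm x (Suc k + j) n) + C' * (\<Sum>j\<le>d. saddle_norm x (k + j) n)"
      by (intro add_mono C C')
    also have "\<dots> \<le> C * (\<Sum>j\<le>Suc d. saddle_norm x (k + j) n) + C' * (\<Sum>j\<le>Suc d. saddle_norm x (k + j) n)"
    proof (intro add_mono mult_left_mono C C')
      show "(\<Sum>j\<le>d. saddle_norm x (Suc k + j) n) \<le> (\<Sum>j\<le>Suc d. saddle_norm x (k + j) n)"
        by (subst sum.atMost_Suc_shift) simp
    qed simp
    finally show ?thesis by (simp add: algebra_simps)
  qed
  then show ?case using C(1) C'(1) by (intro exI[of _ "C + C'"]) auto
qed

text \<open>Integration by parts with \<open>q = P ^ k * p\<close>. The product rule leaves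
  \<open>P ^ k * q1\<close> and \<open>k * P ^ (k - 1) * q2\<close>, where \<open>q1\<close> and
  \<open>q2\<close> have degrees at most 3 and 5; reducing these reaches the levels from
  \<open>k - 1\<close> to \<open>k + 1\<close>.\<close>

lemma saddle_coeff_recurrence:
  assumes p: "degree p \<le> 1"
  obtains D where "D \<ge> 0" "\<And>n. real n * norm (saddle_coeff x n (saddle_poly x ^ Suc k * p)) \<le>
    D * (saddle_norm x (Suc k) n + saddle_norm x k n + (if k = 0 then 0 else saddle_norm x (k - 1) n))"
proof -
  let ?P = "saddle_poly x"
  define q1 where "q1 = [:0, 1:] * (smult (- 1 / 2) ([:1, -1:] * p) + [:1, -1:]\<^sup>2 * pderiv p)"
  define q2 where "q2 = [:0, 1:] * [:1, -1:]\<^sup>2 * pderiv ?P * p"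
  have "degree ([:1, -1:] * p) \<le> 2" "degree ([:1, -1:]\<^sup>2 * pderiv p) \<le> 2"
    using p degree_mult_le[of "[:1, -1:]" p] degree_mult_le[of "[:1, -1:]\<^sup>2" "pderiv p"]
    by (auto simp: degree_pderiv degree_power_eq)
  then have "degree (smult (- 1 / 2) ([:1, -1:] * p) + [:1, -1:]\<^sup>2 * pderiv p) \<le> 2"
    by (intro degree_add_le) (auto simp: degree_smult_le)
  then have "degree q1 \<le> Suc (2 * 1)"
    unfolding q1_def by (intro degree_mult_le[THEN order_trans]) simp
  then obtain C where C: "C \<ge> 0" "\<And>k n. norm (saddle_coeff x n (?P ^ k * q1)) \<le>
       C * (\<Sum>j\<le>1. saddle_norm x (k + j) n)"
    using saddle_coeff_bound by blast
  have "degree ([:0, 1:] * [:1, -1:]\<^sup>2 * pderiv ?P :: complex poly) \<le> 4"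
    by (simp add: saddle_poly_def pderiv_pCons power2_eq_square)
  then have "degree q2 \<le> Suc (2 * 2)"
    unfolding q2_def using p by (intro degree_mult_le[THEN order_trans]) simp
  then obtain C' where C': "C' \<ge> 0" "\<And>k n. norm (saddle_coeff x n (?P ^ k * q2)) \<le>
       C' * (\<Sum>j\<le>2. saddle_norm x (k + j) n)"
    using saddle_coeff_bound by blast
  \<comment> \<open>For \<open>k = 0\<close> the factor \<open>of_nat k\<close> makes the truncated
    \<open>k - 1\<close> harmless.\<close>
  have pow: "[:0, 1:] * (smult (- 1 / 2) ([:1, -1:] * (?P ^ k * p)) + [:1, -1:]\<^sup>2 * pderiv (?P ^ k * p)) =
      ?P ^ k * q1 + smult (of_nat k) (?P ^ (k - 1) * q2)"
  proof (cases k)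
    case 0
    then show ?thesis by (simp add: q1_def)
  next
    case (Suc j)
    have *: "X * (smult h (v * (PP * pp)) + v2 * (PP * pp' + pp * (smult c Pj * P'))) =
       PP * (X * (smult h (v * pp) + v2 * pp')) + smult c (Pj * (X * v2 * P' * pp))"
      for X v v2 PP pp pp' Pj P' :: "complex poly" and h c
      by (simp add: algebra_simps)
    show ?thesis
      unfolding q1_def q2_def pderiv_mult Suc pderiv_power_Suc diff_Suc_1 by (rule *)
  qed
  show thesis
  proof
    show "C + real k * C' \<ge> 0" using C C' by simp
    fix n
    define M where "M = saddle_norm x (Suc k) n + saddle_norm x k n + (if k = 0 then 0 else saddle_norm x (k - 1) n)"
    have "real n * norm (saddle_coeff x n (?P ^ Suc k * p)) =
        norm (of_nat n * saddle_coeff x n (?P * (?P ^ k * p)))"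
      by (simp add: norm_mult mult.assoc)
    also have "\<dots> = norm (saddle_coeff x n (?P ^ k * q1) + of_nat k * saddle_coeff x n (?P ^ (k - 1) * q2))"
      by (simp only: saddle_coeff_mult_saddle_poly pow saddle_coeff_add saddle_coeff_smult)
    also have "\<dots> \<le> norm (saddle_coeff x n (?P ^ k * q1)) + real k * norm (saddle_coeff x n (?P ^ (k - 1) * q2))"
      using norm_triangle_ineq by (metis norm_mult norm_of_nat)
    also have "norm (saddle_coeff x n (?P ^ k * q1)) \<le> C * M"
      by (rule order_trans[OF C(2)]) (use C(1) in \<open>auto simp: M_def intro!: mult_left_mono\<close>)
    also have "real k * norm (saddle_coeff x n (?P ^ (k - 1) * q2)) \<le> real k * (C' * M)"
    proof (cases "k = 0")
      case False
      then have "(\<Sum>j\<le>2. saddle_norm x (k - 1 + j) n) = M"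
        by (auto simp: M_def numeral_2_eq_2)
      with C'(2)[of n "k - 1"] show ?thesis by (intro mult_left_mono) auto
    qed simp
    finally show "real n * norm (saddle_coeff x n (?P ^ Suc k * p)) \<le> (C + real k * C') * M"
      by (simp add: algebra_simps)
  qed
qed

text \<open>The recurrence gives \<open>N_k \<le> (E / n) (N_k + N_(k-1) + N_(k-2))\<close>. The
  first term is absorbed for large \<open>n\<close>. The bound on \<open>N_(k-2)\<close> is the
  weaker of the other two and decides the exponent
  \<open>1 + (k - 1) div 2 = (k + 1) div 2\<close>.\<close>

lemma saddle_norm_asymp:
  "\<exists>C\<ge>0. \<forall>\<^sub>F n in sequentially. saddle_norm x k n \<le> C * (saddle_norm x 0 n / real n ^ ((k + 1) div 2))"
proof (induction k rule: less_induct)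
  case (less k)
  show ?case
  proof (cases k)
    case 0
    then show ?thesis by (intro exI[of _ 1]) simp
  next
    case (Suc m)
    obtain D where D: "D \<ge> 0" "\<And>n. real n * norm (saddle_coeff x n (saddle_poly x ^ Suc m * 1)) \<le>
      D * (saddle_norm x (Suc m) n + saddle_norm x m n + (if m = 0 then 0 else saddle_norm x (m - 1) n))"
      by (rule saddle_coeff_recurrence[of 1]) auto
    obtain D' where D': "D' \<ge> 0" "\<And>n. real n * norm (saddle_coeff x n (saddle_poly x ^ Suc m * [:0, 1:])) \<le>
      D' * (saddle_norm x (Suc m) n + saddle_norm x m n + (if m = 0 then 0 else saddle_norm x (m - 1) n))"
      by (rule saddle_coeff_recurrence[of "[:0, 1:]"]) auto
    define E where "E = D + D'"
    have E: "real n * saddle_norm x k n \<le>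
      E * (saddle_norm x k n + saddle_norm x m n + (if m = 0 then 0 else saddle_norm x (m - 1) n))" for n
      using add_mono[OF D(2)[of n] D'(2)[of n]]
      unfolding saddle_norm_def[of x k] E_def Phi_eq_saddle_coeff[of k] Psi_eq_saddle_coeff[of k] Suc
      by (simp add: saddle_norm_def Phi_eq_saddle_coeff Psi_eq_saddle_coeff algebra_simps)
    have "E \<ge> 0" using D D' by (simp add: E_def)
    obtain C where C: "C \<ge> 0" "\<forall>\<^sub>F n in sequentially. saddle_norm x m n \<le> C * (saddle_norm x 0 n / real n ^ ((m + 1) div 2))"
      using less[of m] Suc by blast
    obtain C' where C': "C' \<ge> 0" "\<forall>\<^sub>F n in sequentially. (if m = 0 then 0 else saddle_norm x (m - 1) n) \<le>
        C' * (saddle_norm x 0 n / real n ^ (m div 2))"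
    proof (cases "m = 0")
      case True
      then show thesis by (intro that[of 0]) auto
    next
      case False
      have "m - 1 < k" using Suc by simp
      from less[OF this] obtain C' where "C' \<ge> 0" "\<forall>\<^sub>F n in sequentially.
          saddle_norm x (m - 1) n \<le> C' * (saddle_norm x 0 n / real n ^ ((m - 1 + 1) div 2))"
        by blast
      with False show thesis by (intro that[of C']) auto
    qed
    \<comment> \<open>From here on \<open>E / n \<le> 1 / 2\<close>, so the level \<open>k\<close>
      term moves to the left at the cost of a factor 2.\<close>
    have "\<forall>\<^sub>F n in sequentially. 2 * E \<le> real n"
      by real_asymp
    with C(2) C'(2) eventually_gt_at_top[of 0]
    have "\<forall>\<^sub>F n in sequentially. saddle_norm x k n \<le>
        (2 * E * (C + C')) * (saddle_norm x 0 n / real n ^ ((k + 1) div 2))"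
    proof eventually_elim
      case (elim n)
      let ?N = "saddle_norm x 0 n / real n ^ (m div 2)"
      have "saddle_norm x 0 n / real n ^ ((m + 1) div 2) \<le> ?N"
        using elim by (intro divide_left_mono power_increasing mult_pos_pos) auto
      then have "saddle_norm x m n \<le> C * ?N"
        using elim(1) mult_left_mono[OF _ C(1)] by (meson order_trans)
      with elim(2) have *: "saddle_norm x m n + (if m = 0 then 0 else saddle_norm x (m - 1) n) \<le> (C + C') * ?N"
        unfolding distrib_right by (intro add_mono)
      have "real n * saddle_norm x k n \<le> E * saddle_norm x k n +
          E * (saddle_norm x m n + (if m = 0 then 0 else saddle_norm x (m - 1) n))"
        using E[of n] by (simp add: algebra_simps)
      also have "\<dots> \<le> real n / 2 * saddle_norm x k n + E * ((C + C') * ?N)"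
        using elim \<open>E \<ge> 0\<close> * by (intro add_mono mult_left_mono mult_right_mono) auto
      also have "real n / 2 * saddle_norm x k n = real n * saddle_norm x k n / 2"
        by simp
      finally have "real n * saddle_norm x k n \<le> 2 * (E * ((C + C') * ?N))"
        by linarith
      then have "real n * saddle_norm x k n \<le> 2 * E * (C + C') * ?N"
        by (simp only: mult.assoc)
      then have "saddle_norm x k n \<le> 2 * E * (C + C') * ?N / real n"
        using elim by (simp add: field_simps)
      also have "\<dots> = 2 * E * (C + C') * (saddle_norm x 0 n / real n ^ ((k + 1) div 2))"
        by (simp add: Suc)
      finally show ?case .
    qed
    then show ?thesis using \<open>E \<ge> 0\<close> C(1) C'(1) by (intro exI[of _ "2 * E * (C + C')"]) auto
  qed
qed

section \<open>Holomorphy and size of the Taylor coefficient functions\<close>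

text \<open>The modulus is \<open>exp (Re (\<beta> * Ln z))\<close>, with the imaginary part of
  \<open>Ln z\<close> bounded by \<pi>. A natural number as bound for \<open>\<beta>\<close> gives a
  power of \<open>m / c\<close>, which later becomes a polynomial in \<open>x\<close>.\<close>

lemma norm_powr_le:
  fixes z \<beta> :: complex
  assumes z: "c \<le> norm z" "norm z \<le> m" and c: "0 < c" "c \<le> 1" and m: "1 \<le> m" and R: "norm \<beta> \<le> real R"
  shows "norm (z powr \<beta>) \<le> exp (real R * pi) * (m / c) ^ R"
proof -
  have nz: "z \<noteq> 0" "norm z > 0" using z c by auto
  have "ln (norm z) \<le> ln m" using z nz m by simp
  moreover have "ln c \<le> ln (norm z)" using z nz c by simp
  moreover have "0 \<le> ln m" "ln c \<le> 0" using m c by auto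
  ultimately have abs: "\<bar>ln (norm z)\<bar> \<le> ln m - ln c" by simp
  have "norm (Ln z) \<le> \<bar>Re (Ln z)\<bar> + \<bar>Im (Ln z)\<bar>" by (rule cmod_le)
  also have "\<bar>Im (Ln z)\<bar> \<le> pi" using nz mpi_less_Im_Ln[of z] Im_Ln_le_pi[of z] by simp
  also have "\<bar>Re (Ln z)\<bar> \<le> ln m - ln c" using abs nz by simp
  finally have Ln: "norm (Ln z) \<le> pi + (ln m - ln c)" by simp
  have "norm (z powr \<beta>) = exp (Re (\<beta> * Ln z))"
    using nz by (simp add: powr_def)
  also have "Re (\<beta> * Ln z) \<le> norm \<beta> * norm (Ln z)"
    by (metis complex_Re_le_cmod norm_mult)
  also have "\<dots> \<le> real R * (pi + (ln m - ln c))"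
    using R Ln by (intro mult_mono) auto
  also have "exp \<dots> = exp (real R * pi) * exp (ln m - ln c) ^ R"
    by (simp add: distrib_left exp_add flip: exp_of_nat_mult)
  also have "exp (ln m - ln c) = m / c" using m c by (simp add: exp_diff)
  finally show ?thesis by simp
qed

text \<open>An even \<open>h\<close> does not see the choice of the root. Away from 0 a local
  holomorphic branch may therefore replace \<open>csqrt\<close>, and its cut disappears; at 0 the
  singularity is removable by continuity.\<close>

lemma even_holomorphic_csqrt:
  assumes h: "h holomorphic_on {d. d\<^sup>2 \<in> U}" and U: "open U" and even: "\<And>d. h (- d) = h d"
  shows "(\<lambda>v. h (csqrt v)) holomorphic_on U"
proof -
  let ?D = "{d. d\<^sup>2 \<in> U}"
  have D: "open ?D"
  proof -
    have "open ((\<lambda>d. d\<^sup>2) -` U)" by (intro open_vimage U continuous_intros)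
    then show ?thesis by (simp add: vimage_def)
  qed
  have root: "h d = h (csqrt (d\<^sup>2))" for d
  proof -
    have "(csqrt (d\<^sup>2))\<^sup>2 = d\<^sup>2" by simp
    then have "csqrt (d\<^sup>2) = d \<or> csqrt (d\<^sup>2) = - d" by (simp only: power2_eq_iff)
    then show ?thesis using even by auto
  qed
  show ?thesis
  proof (rule no_isolated_singularity'[where K = "{0} \<inter> U"])
    show "((\<lambda>v. h (csqrt v)) \<longlongrightarrow> h (csqrt z)) (at z within U)" if "z \<in> {0} \<inter> U" for z
    proof -
      have "z = 0" "0 \<in> ?D" using that by auto
      have "isCont h 0"
        using h D \<open>0 \<in> ?D\<close> holomorphic_on_imp_continuous_on continuous_on_eq_continuous_at by blast
      moreover have "csqrt \<midarrow>0\<rightarrow> 0"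
      proof (rule Lim_null_comparison)
        show "((\<lambda>v. sqrt (norm v)) \<longlongrightarrow> 0) (at (0::complex))"
          by (rule tendsto_eq_intros | simp)+
      qed (simp add: norm_csqrt)
      ultimately have "(\<lambda>v. h (csqrt v)) \<midarrow>0\<rightarrow> h 0"
        by (rule isCont_tendsto_compose)
      then show ?thesis using \<open>z = 0\<close> by (auto intro: tendsto_within_subset)
    qed
    show "(\<lambda>v. h (csqrt v)) holomorphic_on U - {0} \<inter> U"
      unfolding holomorphic_on_def
    proof
      fix v1 assume v1: "v1 \<in> U - {0} \<inter> U"
      \<comment> \<open>a branch of the square root that is holomorphic near \<open>v1\<close>\<close>
      define q where "q v = csqrt v1 * csqrt (v / v1)" for v
      define W where "W = U \<inter> ball v1 (norm v1)"
      have "v1 \<noteq> 0" using v1 by auto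
      have "open W" "v1 \<in> W" using U v1 by (auto simp: W_def)
      have q2: "(q v)\<^sup>2 = v" for v using \<open>v1 \<noteq> 0\<close> by (simp add: q_def power_mult_distrib)
      \<comment> \<open>The ball has radius \<open>norm v1\<close>, which keeps
        \<open>v / v1\<close> in the right half-plane.\<close>
      have "v / v1 \<notin> \<real>\<^sub>\<le>\<^sub>0" if "v \<in> W" for v
      proof -
        have "norm (v1 - v) < norm v1" using that by (simp add: W_def dist_norm)
        moreover have "norm (v1 - v) = norm v1 * norm (1 - v / v1)"
          using \<open>v1 \<noteq> 0\<close> by (subst norm_mult[symmetric]) (simp add: right_diff_distrib)
        ultimately have "norm (1 - v / v1) < 1" using \<open>v1 \<noteq> 0\<close> by auto
        then have "Re (v / v1) > 0" using complex_Re_le_cmod[of "1 - v / v1"] by simp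
        then show ?thesis by (auto simp: complex_nonpos_Reals_iff)
      qed
      then have "q holomorphic_on W"
        unfolding q_def using \<open>v1 \<noteq> 0\<close> by (intro holomorphic_intros) auto
      moreover have "q ` W \<subseteq> ?D" using q2 by (auto simp: W_def)
      ultimately have "(\<lambda>v. h (q v)) holomorphic_on W"
        using holomorphic_on_compose_gen[of q W h ?D] h by (simp add: o_def)
      then have "(\<lambda>v. h (csqrt v)) holomorphic_on W"
        by (rule holomorphic_transform) (metis q2 root)
      then show "(\<lambda>v. h (csqrt v)) field_differentiable at v1 within U - {0} \<inter> U"
        using \<open>open W\<close> \<open>v1 \<in> W\<close>
        by (meson field_differentiable_at_within holomorphic_on_imp_differentiable_at)
    qed
  qed (use U in auto)
qed

text \<open>
  With \<open>s\<^sub>1 = x / 2 + d\<close> and \<open>s\<^sub>2 = x / 2 - d\<close> this is \<open>(s\<^sub>1\<^sup>\<beta> - s\<^sub>2\<^sup>\<beta>) / (s\<^sub>1 - s\<^sub>2)\<close>. It is even in \<open>d\<close>,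
  hence a holomorphic function of \<open>d\<^sup>2 = x\<^sup>2 / 4 - x + u\<close>.
\<close>

definition powr_quotient :: "complex \<Rightarrow> real \<Rightarrow> complex \<Rightarrow> complex" where
  "powr_quotient \<beta> x d = (if d = 0 then \<beta> * (of_real x / 2) powr (\<beta> - 1)
     else ((of_real x / 2 + d) powr \<beta> - (of_real x / 2 - d) powr \<beta>) / (2 * d))"

definition powr_slope :: "complex \<Rightarrow> real \<Rightarrow> complex \<Rightarrow> complex" where
  "powr_slope \<beta> x u = powr_quotient \<beta> x (csqrt (of_real (x\<^sup>2 / 4 - x) + u))"

lemma powr_quotient_minus: "powr_quotient \<beta> x (- d) = powr_quotient \<beta> x d"
  by (simp add: powr_quotient_def divide_simps)

text \<open>The product form suits the two roots of \<open>P w = u\<close>: their product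
  \<open>x - u\<close> has positive real part for \<open>norm u < x\<close>, which excludes both
  from the cut.\<close>

lemma Re_mult_pos_imp_not_nonpos:
  assumes "Re (s * (of_real x - s)) > 0" "x > 0"
  shows "s \<notin> \<real>\<^sub>\<le>\<^sub>0"
proof
  assume "s \<in> \<real>\<^sub>\<le>\<^sub>0"
  then obtain t where "s = of_real t" "t \<le> 0" by (auto elim!: nonpos_Reals_cases)
  then have "t * (x - t) > 0" using assms by simp
  moreover have "t * (x - t) \<le> 0" using \<open>t \<le> 0\<close> \<open>x > 0\<close> by (intro mult_nonpos_nonneg) auto
  ultimately show False by simp
qed

lemma powr_quotient_holomorphic:
  assumes x: "x > 0"
  shows "powr_quotient \<beta> x holomorphic_on {d. Re (of_real (x\<^sup>2 / 4) - d\<^sup>2) > 0}" (is "_ holomorphic_on ?D")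
proof (rule no_isolated_singularity'[where K = "{0}"])
  have slit: "of_real x / 2 + d \<notin> \<real>\<^sub>\<le>\<^sub>0" "of_real x / 2 - d \<notin> \<real>\<^sub>\<le>\<^sub>0" if "d \<in> ?D" for d
  proof -
    have *: "(of_real x / 2 + d) * (of_real x - (of_real x / 2 + d)) = of_real (x\<^sup>2 / 4) - d\<^sup>2"
      "(of_real x / 2 - d) * (of_real x - (of_real x / 2 - d)) = of_real (x\<^sup>2 / 4) - d\<^sup>2"
      by (simp_all add: algebra_simps power2_eq_square)
    show "of_real x / 2 + d \<notin> \<real>\<^sub>\<le>\<^sub>0" "of_real x / 2 - d \<notin> \<real>\<^sub>\<le>\<^sub>0"
      by (rule Re_mult_pos_imp_not_nonpos[of _ x]; use that x in \<open>simp only: * mem_Collect_eq\<close>)+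
  qed
  show "open ?D" by (intro open_Collect_less continuous_intros)
  have "(\<lambda>d. ((of_real x / 2 + d) powr \<beta> - (of_real x / 2 - d) powr \<beta>) / (2 * d)) holomorphic_on ?D - {0}"
    using slit by (intro holomorphic_intros) auto
  then show "powr_quotient \<beta> x holomorphic_on ?D - {0}"
    by (rule holomorphic_transform) (simp add: powr_quotient_def)
  show "(powr_quotient \<beta> x \<longlongrightarrow> powr_quotient \<beta> x z) (at z within ?D)" if "z \<in> {0}" for z
  proof -
    let ?g = "\<lambda>d. (of_real x / 2 + d) powr \<beta> - (of_real x / 2 - d) powr \<beta>"
    have "of_real x / 2 \<notin> (\<real>\<^sub>\<le>\<^sub>0 :: complex set)" using x by (auto simp: complex_nonpos_Reals_iff)
    \<comment> \<open>The numerator vanishes at 0, so its quotient by \<open>d\<close> tends to this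
      derivative; the value chosen at \<open>d = 0\<close> is half of it.\<close>
    then have "(?g has_field_derivative 2 * (\<beta> * (of_real x / 2) powr (\<beta> - 1))) (at 0)"
      by (auto intro!: derivative_eq_intros)
    then have "(\<lambda>d. ?g d / d) \<midarrow>0\<rightarrow> 2 * (\<beta> * (of_real x / 2) powr (\<beta> - 1))"
      by (simp add: has_field_derivative_iff)
    then have "(\<lambda>d. ?g d / d / 2) \<midarrow>0\<rightarrow> 2 * (\<beta> * (of_real x / 2) powr (\<beta> - 1)) / 2"
      by (rule tendsto_divide) auto
    then have "(\<lambda>d. ?g d / d / 2) \<midarrow>0\<rightarrow> powr_quotient \<beta> x 0"
      by (simp add: powr_quotient_def)
    then have "powr_quotient \<beta> x \<midarrow>0\<rightarrow> powr_quotient \<beta> x 0"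
      by (rule Lim_transform_eventually)
         (auto simp: eventually_at_filter powr_quotient_def mult.commute intro!: always_eventually)
    then show ?thesis using that by (auto intro: tendsto_within_subset)
  qed
qed auto

text \<open>Since \<open>x\<^sup>2 / 4 - d\<^sup>2 = x - u\<close>, the condition
  \<open>norm u < x\<close> puts \<open>d\<close> into the domain of \<open>powr_quotient\<close>;
  evenness then removes the cut of the root.\<close>

lemma powr_slope_holomorphic:
  assumes x: "x > 0"
  shows "powr_slope \<beta> x holomorphic_on ball 0 x"
proof -
  define c where "c = complex_of_real (x\<^sup>2 / 4 - x)"
  define U where "U = ball c x"
  have "powr_quotient \<beta> x holomorphic_on {d. d\<^sup>2 \<in> U}"
  proof (rule holomorphic_on_subset[OF powr_quotient_holomorphic[OF x]], safe)
    fix d assume "d\<^sup>2 \<in> U"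
    then have "norm (d\<^sup>2 - c) < x" by (simp add: U_def dist_norm norm_minus_commute)
    then have "Re (d\<^sup>2 - c) < x" using complex_Re_le_cmod[of "d\<^sup>2 - c"] by linarith
    then show "Re (of_real (x\<^sup>2 / 4) - d\<^sup>2) > 0" by (simp add: c_def)
  qed
  then have "(\<lambda>v. powr_quotient \<beta> x (csqrt v)) holomorphic_on U"
    by (rule even_holomorphic_csqrt) (auto simp: U_def powr_quotient_minus)
  moreover have "(\<lambda>u. c + u) holomorphic_on ball 0 x" by (intro holomorphic_intros)
  moreover have "(\<lambda>u. c + u) ` ball 0 x \<subseteq> U" by (auto simp: U_def dist_norm)
  ultimately have "(\<lambda>v. powr_quotient \<beta> x (csqrt v)) \<circ> (\<lambda>u. c + u) holomorphic_on ball 0 x"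
    by (intro holomorphic_on_compose_gen)
  then show ?thesis
    by (simp add: o_def c_def powr_slope_def[abs_def])
qed

text \<open>The two roots of \<open>s\<^sup>2 - x s + x = u\<close> are \<open>s\<close> and \<open>x - s\<close>.\<close>

lemma powr_slope_eq:
  "(2 * s - of_real x) * powr_slope \<beta> x (s\<^sup>2 - of_real x * s + of_real x) =
     s powr \<beta> - (of_real x - s) powr \<beta>"
proof -
  define d where "d = s - of_real x / 2"
  have "of_real (x\<^sup>2 / 4 - x) + (s\<^sup>2 - of_real x * s + of_real x) = d\<^sup>2"
    by (simp add: d_def algebra_simps power2_eq_square)
  then have "powr_slope \<beta> x (s\<^sup>2 - of_real x * s + of_real x) = powr_quotient \<beta> x (csqrt (d\<^sup>2))"
    by (simp only: powr_slope_def)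
  moreover have "(csqrt (d\<^sup>2))\<^sup>2 = d\<^sup>2" by simp
  then have "csqrt (d\<^sup>2) = d \<or> csqrt (d\<^sup>2) = - d" by (simp only: power2_eq_iff)
  then have "powr_quotient \<beta> x (csqrt (d\<^sup>2)) = powr_quotient \<beta> x d"
    using powr_quotient_minus by auto
  moreover have "2 * s - of_real x = 2 * d" by (simp add: d_def)
  moreover have "of_real x / 2 + d = s" "of_real x / 2 - d = of_real x - s"
    by (simp_all add: d_def field_simps)
  ultimately show ?thesis
    by (auto simp: powr_quotient_def)
qed

text \<open>Linear interpolation of the power at the roots \<open>s\<close> and
  \<open>x - s\<close>, whose product is \<open>x - u\<close>. The constant term is minus this
  product times the divided difference for \<open>\<beta> - 1\<close>. For a double root the divided
  differences are derivatives.\<close>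

lemma powr_decomposition:
  assumes s: "s \<noteq> 0" "s \<noteq> of_real x" and x: "x > 0"
  defines "u \<equiv> s\<^sup>2 - of_real x * s + of_real x"
  shows "s powr \<beta> = - (of_real x - u) * powr_slope (\<beta> - 1) x u + powr_slope \<beta> x u * s"
proof (cases "2 * s = of_real x")
  case True
  have "u = of_real x - s\<^sup>2" using True by (simp add: u_def power2_eq_square)
  then have "csqrt (of_real (x\<^sup>2 / 4 - x) + u) = 0"
    using True[symmetric] by (simp add: power2_eq_square)
  moreover have "of_real x / 2 = s" unfolding True[symmetric] by simp
  ultimately have slope: "powr_slope \<gamma> x u = \<gamma> * s powr (\<gamma> - 1)" for \<gamma>
    by (simp only: powr_slope_def powr_quotient_def simp_thms if_True)
  have "of_real x - u = s\<^sup>2" using \<open>u = of_real x - s\<^sup>2\<close> by simp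
  moreover have "s powr (\<beta> - 1) = s powr \<beta> / s" "s powr (\<beta> - 1 - 1) = s powr \<beta> / s\<^sup>2"
    using s by (simp_all add: powr_diff power2_eq_square)
  ultimately show ?thesis
    unfolding slope using s by (simp add: field_simps)
next
  case False
  let ?t = "of_real x - s"
  have prod: "of_real x - u = s * ?t" by (simp add: u_def algebra_simps power2_eq_square)
  have "(2 * s - of_real x) * (- (of_real x - u) * powr_slope (\<beta> - 1) x u + powr_slope \<beta> x u * s) =
     - (s * ?t) * (s powr (\<beta> - 1) - ?t powr (\<beta> - 1)) + (s powr \<beta> - ?t powr \<beta>) * s"
    unfolding prod powr_slope_eq[of s x, folded u_def, symmetric] by (simp add: algebra_simps)
  also have "\<dots> = (2 * s - of_real x) * s powr \<beta>"
    using s by (simp add: powr_diff field_simps)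
  finally show ?thesis using False by simp
qed

text \<open>Mean value estimate on the segment joining the roots. For \<open>p\<close> on it,
  \<open>Re (p * (x - p))\<close> is a convex combination of \<open>x\<^sup>2 / 4\<close> and
  \<open>x - Re u\<close>, hence at least \<open>4 c x\<close>. With
  \<open>norm (x - p) \<le> 4 x\<close> this keeps \<open>p\<close> off the cut and
  \<open>norm p\<close> above \<open>c\<close>.\<close>

lemma powr_slope_bound:
  assumes x: "x \<ge> 1" and \<theta>: "0 < \<theta>" "\<theta> < 1" and R: "norm (\<beta> - 1) \<le> real R" and u: "norm u \<le> \<theta> * x"
  shows "norm (powr_slope \<beta> x u) \<le> (real R + 1) * (exp (real R * pi) * (64 / (1 - \<theta>) * x) ^ R)"
proof -
  define d where "d = csqrt (of_real (x\<^sup>2 / 4 - x) + u)"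
  \<comment> \<open>Chosen so that \<open>4 c\<close> is at most \<open>1 / 4\<close> and at most
    \<open>1 - \<theta>\<close>, which serve the two parts of the convex combination.\<close>
  define c where "c = (1 - \<theta>) / 16"
  define M where "M = (real R + 1) * (exp (real R * pi) * (64 / (1 - \<theta>) * x) ^ R)"
  have d2: "d\<^sup>2 = of_real (x\<^sup>2 / 4 - x) + u" by (simp add: d_def)
  have c: "0 < c" "c \<le> 1" using \<theta> by (auto simp: c_def)
  have xx: "x \<le> x\<^sup>2" using x by (simp add: power2_eq_square)
  have "norm u \<le> x" using u \<theta> x by (meson mult_left_le_one_le less_imp_le order_trans zero_le_one)
  have "(norm d)\<^sup>2 \<le> norm (of_real (x\<^sup>2 / 4 - x) :: complex) + norm u"
    unfolding norm_power[symmetric] d2 by (rule norm_triangle_ineq)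
  also have "\<dots> \<le> (x\<^sup>2 + x) + x"
    using \<open>norm u \<le> x\<close> x xx unfolding norm_of_real by (intro add_mono) (auto simp: abs_le_iff)
  also have "\<dots> \<le> 4 * x\<^sup>2" using xx zero_le_power2[of x] by linarith
  also have "\<dots> = (2 * x)\<^sup>2" by (simp add: power_mult_distrib)
  finally have nd: "norm d \<le> 2 * x" by (rule power2_le_imp_le) (use x in simp)
  have pt: "of_real x / 2 + t * d \<notin> \<real>\<^sub>\<le>\<^sub>0 \<and> norm (\<beta> * (of_real x / 2 + t * d) powr (\<beta> - 1)) \<le> M"
    if t: "\<bar>t\<bar> \<le> 1" for t :: real
  proof -
    define p where "p = of_real x / 2 + t * d"
    have "t\<^sup>2 \<le> 1" using t by (simp add: abs_square_le_1)
    have "p * (of_real x - p) = of_real (x\<^sup>2 / 4) - of_real (t\<^sup>2) * d\<^sup>2"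
      by (simp add: p_def algebra_simps power2_eq_square)
    also have "\<dots> = of_real ((1 - t\<^sup>2) * (x\<^sup>2 / 4) + t\<^sup>2 * x) - of_real (t\<^sup>2) * u"
      unfolding d2 by (simp add: field_simps)
    also have "Re \<dots> = (1 - t\<^sup>2) * (x\<^sup>2 / 4) + t\<^sup>2 * (x - Re u)"
      by (simp add: algebra_simps del: of_real_power of_real_mult of_real_add of_real_diff of_real_divide)
    finally have Re_eq: "Re (p * (of_real x - p)) = (1 - t\<^sup>2) * (x\<^sup>2 / 4) + t\<^sup>2 * (x - Re u)" .
    have A: "(1 - t\<^sup>2) * (c * 4 * x) \<le> (1 - t\<^sup>2) * (x\<^sup>2 / 4)"
    proof (rule mult_left_mono)
      have "c * 4 * x \<le> 1 / 4 * x" using x \<theta> by (intro mult_right_mono) (auto simp: c_def)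
      also have "\<dots> \<le> x\<^sup>2 / 4" using xx by simp
      finally show "c * 4 * x \<le> x\<^sup>2 / 4" .
    qed (use \<open>t\<^sup>2 \<le> 1\<close> in simp)
    have B: "t\<^sup>2 * (c * 4 * x) \<le> t\<^sup>2 * (x - Re u)"
    proof (rule mult_left_mono)
      have "Re u \<le> \<theta> * x" using u complex_Re_le_cmod[of u] by linarith
      moreover have "c * 4 * x \<le> (1 - \<theta>) * x"
        using x \<theta> by (intro mult_right_mono) (auto simp: c_def)
      ultimately show "c * 4 * x \<le> x - Re u" by (simp add: algebra_simps)
    qed simp
    have "c * 4 * x = (1 - t\<^sup>2) * (c * 4 * x) + t\<^sup>2 * (c * 4 * x)"
      by (simp add: algebra_simps)
    also have "\<dots> \<le> Re (p * (of_real x - p))"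
      unfolding Re_eq by (intro add_mono A B)
    finally have Re: "c * 4 * x \<le> Re (p * (of_real x - p))" .
    have pos: "c * 4 * x > 0" using c x by simp
    have "p \<notin> \<real>\<^sub>\<le>\<^sub>0" using Re pos x by (intro Re_mult_pos_imp_not_nonpos[of _ x]) auto
    have "norm (t * d) \<le> 1 * (2 * x)" unfolding norm_mult using t nd by (intro mult_mono) auto
    then have np: "norm p \<le> 4 * x" "norm (of_real x - p) \<le> 4 * x"
      using x norm_triangle_ineq[of "of_real x / 2" "t * d"] norm_triangle_ineq4[of "of_real x / 2" "t * d"]
      by (auto simp: p_def norm_divide algebra_simps)
    have "c * (4 * x) \<le> norm p * (4 * x)"
    proof -
      have "c * 4 * x \<le> norm (p * (of_real x - p))" using Re complex_Re_le_cmod order_trans by blast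
      also have "\<dots> \<le> norm p * (4 * x)" unfolding norm_mult using np by (intro mult_left_mono) auto
      finally show ?thesis by simp
    qed
    then have "c \<le> norm p" using x by simp
    then have "norm (p powr (\<beta> - 1)) \<le> exp (real R * pi) * (4 * x / c) ^ R"
      using np c x R by (intro norm_powr_le) auto
    also have "4 * x / c = 64 / (1 - \<theta>) * x" by (simp add: c_def)
    finally have "norm (p powr (\<beta> - 1)) \<le> exp (real R * pi) * (64 / (1 - \<theta>) * x) ^ R" .
    moreover have "norm \<beta> \<le> real R + 1"
      using R norm_triangle_ineq[of "\<beta> - 1" 1] by simp
    ultimately have "norm (\<beta> * p powr (\<beta> - 1)) \<le> M"
      unfolding norm_mult M_def by (intro mult_mono) auto
    with \<open>p \<notin> \<real>\<^sub>\<le>\<^sub>0\<close> show ?thesis by (simp add: p_def)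
  qed
  have "norm (powr_quotient \<beta> x d) \<le> M"
  proof (cases "d = 0")
    case True
    then show ?thesis using pt[of 0] by (simp add: powr_quotient_def)
  next
    case False
    let ?a = "of_real x / 2 - d" and ?b = "of_real x / 2 + d"
    have "norm (?b powr \<beta> - ?a powr \<beta>) \<le> M * norm (?b - ?a)"
    proof (rule field_differentiable_bound[OF convex_closed_segment])
      fix z assume "z \<in> closed_segment ?a ?b"
      then obtain r where r: "0 \<le> r" "r \<le> 1" "z = (1 - r) *\<^sub>R ?a + r *\<^sub>R ?b"
        by (auto simp: closed_segment_def)
      have "z = of_real x / 2 + of_real (2 * r - 1) * d"
        unfolding r(3) by (simp add: scaleR_conv_of_real field_simps)
      moreover have "\<bar>2 * r - 1\<bar> \<le> 1" using r by auto
      ultimately have z: "z \<notin> \<real>\<^sub>\<le>\<^sub>0" "norm (\<beta> * z powr (\<beta> - 1)) \<le> M" using pt by blast+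
      show "((\<lambda>z. z powr \<beta>) has_field_derivative \<beta> * z powr (\<beta> - 1)) (at z within closed_segment ?a ?b)"
        using z(1) by (auto intro!: derivative_eq_intros)
      show "norm (\<beta> * z powr (\<beta> - 1)) \<le> M" by (rule z(2))
    qed auto
    then have "norm (?b powr \<beta> - ?a powr \<beta>) \<le> M * norm (2 * d)" by simp
    then show ?thesis using False by (simp add: powr_quotient_def norm_divide divide_le_eq)
  qed
  then show ?thesis by (simp add: powr_slope_def d_def M_def)
qed

section \<open>Convergence of the expansion\<close>

lemma holomorphic_Taylor_coeff_bound:
  assumes F: "F holomorphic_on ball 0 X" and \<rho>: "0 < \<rho>" "\<rho> < X"
    and M: "\<And>u. norm u \<le> \<rho> \<Longrightarrow> norm (F u) \<le> M"
  shows "norm ((deriv ^^ k) F 0 / fact k) \<le> M / \<rho> ^ k"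
proof -
  have "F holomorphic_on cball 0 \<rho>" using F \<rho> by (auto elim: holomorphic_on_subset)
  then have "norm ((deriv ^^ k) F 0) \<le> fact k * M / \<rho> ^ k"
    using \<rho> M by (intro Cauchy_inequality)
      (auto intro: holomorphic_on_imp_continuous_on holomorphic_on_subset[OF _ ball_subset_cball])
  then have "norm ((deriv ^^ k) F 0) / fact k \<le> fact k * M / \<rho> ^ k / fact k"
    by (rule divide_right_mono) simp
  then show ?thesis by (simp add: norm_divide)
qed

text \<open>The coefficient bounds \<open>M / \<rho> ^ k\<close> dominate the tail by a geometric
  series of ratio \<open>\<mu> / \<rho>\<close>.\<close>

lemma holomorphic_Taylor_remainder_bound:
  assumes F: "F holomorphic_on ball 0 X" and \<rho>: "0 < \<rho>" "\<rho> < X"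
    and M: "\<And>u. norm u \<le> \<rho> \<Longrightarrow> norm (F u) \<le> M"
    and u: "norm u \<le> \<mu>" and \<mu>: "\<mu> < \<rho>"
  shows "norm (F u - (\<Sum>k<N. (deriv ^^ k) F 0 / fact k * u ^ k)) \<le> M * (\<mu> / \<rho>) ^ N / (1 - \<mu> / \<rho>)"
proof -
  define q where "q = \<mu> / \<rho>"
  define t where "t k = (deriv ^^ k) F 0 / fact k * u ^ k" for k
  have "0 \<le> \<mu>" using u norm_ge_zero order_trans by blast
  then have q: "0 \<le> q" "q < 1" using \<rho> \<mu> by (auto simp: q_def)
  have "0 \<le> M" using order_trans[OF norm_ge_zero M[of 0]] \<rho> by simp
  have t: "norm (t k) \<le> M * q ^ k" for k
  proof -
    have "norm (t k) \<le> (M / \<rho> ^ k) * \<mu> ^ k"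
      unfolding t_def norm_mult norm_power
      using holomorphic_Taylor_coeff_bound[OF F \<rho> M] u \<open>0 \<le> M\<close> \<rho>
      by (intro mult_mono power_mono) auto
    then show ?thesis by (simp add: q_def power_divide)
  qed
  have "t sums F u"
    using holomorphic_power_series[OF F, of u] u \<mu> \<rho> by (simp add: t_def[abs_def])
  then have "(\<lambda>k. t (k + N)) sums (F u - (\<Sum>k<N. t k))"
    by (rule sums_split_initial_segment)
  moreover have geo: "(\<lambda>k. M * q ^ (k + N)) sums (M * q ^ N / (1 - q))"
  proof -
    have "(\<lambda>k. M * q ^ N * q ^ k) sums (M * q ^ N * (1 / (1 - q)))"
      using q by (intro sums_mult geometric_sums) auto
    then show ?thesis by (simp add: power_add mult_ac)
  qed
  moreover have "norm (\<Sum>k. t (k + N)) \<le> (\<Sum>k. M * q ^ (k + N))"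
    by (rule norm_suminf_le[OF t sums_summable[OF geo]])
  ultimately show ?thesis by (simp add: sums_iff q_def t_def)
qed

text \<open>\<open>powr_decomposition\<close> at \<open>s = 1 - w\<close>, with the multiple of
  \<open>s\<close> split into a constant and a multiple of \<open>w\<close>; the latter becomes
  \<open>taylor_B\<close>.\<close>

definition taylor_A :: "complex \<Rightarrow> real \<Rightarrow> complex \<Rightarrow> complex" where
  "taylor_A \<alpha> x u = powr_slope (1 / 2 - \<alpha>) x u - (of_real x - u) * powr_slope (1 / 2 - \<alpha> - 1) x u"

definition taylor_B :: "complex \<Rightarrow> real \<Rightarrow> complex \<Rightarrow> complex" where
  "taylor_B \<alpha> x u = - powr_slope (1 / 2 - \<alpha>) x u"

lemma taylor_holomorphic:
  assumes "x > 0"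
  shows "taylor_A \<alpha> x holomorphic_on ball 0 x" "taylor_B \<alpha> x holomorphic_on ball 0 x"
  unfolding taylor_A_def[abs_def] taylor_B_def[abs_def]
  by (intro holomorphic_intros powr_slope_holomorphic assms)+

lemma one_minus_powr_eq_taylor:
  assumes x: "x > 0" and w: "norm ((1 - w)\<^sup>2 + of_real x * w) < x"
  shows "(1 - w) powr (1 / 2 - \<alpha>) =
    taylor_A \<alpha> x ((1 - w)\<^sup>2 + of_real x * w) + taylor_B \<alpha> x ((1 - w)\<^sup>2 + of_real x * w) * w"
proof -
  have u: "(1 - w)\<^sup>2 + of_real x * w = (1 - w)\<^sup>2 - of_real x * (1 - w) + of_real x"
    by (simp add: algebra_simps)
  \<comment> \<open>Both \<open>1 - w = 0\<close> and \<open>1 - w = x\<close> would make the value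
    of the saddle polynomial equal to \<open>x\<close>.\<close>
  have "1 - w \<noteq> 0"
  proof
    assume "1 - w = 0"
    then have "w = 1" by simp
    with w x show False by simp
  qed
  moreover have "1 - w \<noteq> of_real x"
  proof
    assume "1 - w = of_real x"
    then have "(1 - w)\<^sup>2 - of_real x * (1 - w) + of_real x = of_real x" by (simp add: power2_eq_square)
    with w x show False unfolding u by simp
  qed
  ultimately show ?thesis
    unfolding u by (subst powr_decomposition[OF _ _ x])
      (simp_all add: taylor_A_def taylor_B_def algebra_simps)
qed

lemma coeff_eq_taylor:
  assumes x: "x > 0"
  shows "coeff_A \<alpha> x k = (deriv ^^ k) (taylor_A \<alpha> x) 0 / fact k"
    and "coeff_B \<alpha> x k = (deriv ^^ k) (taylor_B \<alpha> x) 0 / fact k"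
proof -
  have "two_point_coeffs (\<lambda>w. (1 - w) powr (1 / 2 - \<alpha>)) (w_plus x) (w_minus x) =
    (\<lambda>k. (deriv ^^ k) (taylor_A \<alpha> x) 0 / fact k, \<lambda>k. (deriv ^^ k) (taylor_B \<alpha> x) 0 / fact k)"
    using taylor_holomorphic[OF x] x one_minus_powr_eq_taylor[OF x]
    by (intro two_point_coeffsI) (auto simp: w_plus_minus_zeros)
  then show "coeff_A \<alpha> x k = (deriv ^^ k) (taylor_A \<alpha> x) 0 / fact k"
    "coeff_B \<alpha> x k = (deriv ^^ k) (taylor_B \<alpha> x) 0 / fact k"
    by (simp_all add: coeff_A_def coeff_B_def)
qed

text \<open>The margin 2 leaves room for the exponents \<open>- 1 / 2 - \<alpha>\<close> and
  \<open>- 3 / 2 - \<alpha>\<close>; the factor \<open>x - u\<close> costs one more power of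
  \<open>x\<close>.\<close>

lemma taylor_bound:
  assumes \<theta>: "0 < \<theta>" "\<theta> < 1"
  obtains C where "C \<ge> 0"
    "\<And>x \<alpha> u. 1 \<le> x \<Longrightarrow> norm \<alpha> + 2 \<le> real R \<Longrightarrow> norm u \<le> \<theta> * x \<Longrightarrow>
      norm (taylor_A \<alpha> x u) \<le> C * x ^ Suc R \<and> norm (taylor_B \<alpha> x u) \<le> C * x ^ Suc R"
proof
  define C where "C = (real R + 1) * (exp (real R * pi) * (64 / (1 - \<theta>)) ^ R)"
  show "3 * C \<ge> 0" using \<theta> by (simp add: C_def)
  fix x :: real and \<alpha> u :: complex
  assume x: "1 \<le> x" and \<alpha>: "norm \<alpha> + 2 \<le> real R" and u: "norm u \<le> \<theta> * x"
  have eq: "(real R + 1) * (exp (real R * pi) * (64 / (1 - \<theta>) * x) ^ R) = C * x ^ R"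
    by (simp only: C_def power_mult_distrib mult.assoc)
  have "1 / 2 - \<alpha> - 1 = - 1 / 2 - \<alpha>" "1 / 2 - \<alpha> - 1 - 1 = - 3 / 2 - \<alpha>"
    by simp_all
  then have N: "norm (1 / 2 - \<alpha> - 1) \<le> real R" "norm (1 / 2 - \<alpha> - 1 - 1) \<le> real R"
    using \<alpha> norm_triangle_ineq4[of "- 1 / 2" \<alpha>] norm_triangle_ineq4[of "- 3 / 2" \<alpha>]
    by simp_all
  have s: "norm (powr_slope (1 / 2 - \<alpha>) x u) \<le> C * x ^ R"
     "norm (powr_slope (1 / 2 - \<alpha> - 1) x u) \<le> C * x ^ R"
    unfolding eq[symmetric]
    by (rule powr_slope_bound[OF x \<theta> N(1) u], rule powr_slope_bound[OF x \<theta> N(2) u])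
  have xu: "norm (of_real x - u) \<le> 2 * x"
  proof -
    have "norm (of_real x - u) \<le> x + norm u"
      using norm_triangle_ineq4[of "of_real x" u] x by simp
    also have "norm u \<le> x" using u \<theta> x
      by (meson mult_left_le_one_le less_imp_le order_trans zero_le_one)
    finally show ?thesis by simp
  qed
  have "C \<ge> 0" using \<theta> by (simp add: C_def)
  have le: "C * x ^ R \<le> C * x ^ Suc R" using x \<open>C \<ge> 0\<close>
    by (intro mult_left_mono power_increasing) auto
  have "norm (taylor_A \<alpha> x u) \<le> C * x ^ R + (2 * x) * (C * x ^ R)"
    unfolding taylor_A_def
    by (rule order_trans[OF norm_triangle_ineq4])
       (use s xu x in \<open>auto simp: norm_mult intro!: add_mono mult_mono\<close>)
  also have "\<dots> \<le> 3 * C * x ^ Suc R" using le by simp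
  finally have A: "norm (taylor_A \<alpha> x u) \<le> 3 * C * x ^ Suc R" .
  have "norm (taylor_B \<alpha> x u) \<le> C * x ^ R" using s(1) by (simp add: taylor_B_def)
  also have "\<dots> \<le> 3 * (C * x ^ Suc R)"
  proof -
    have "0 \<le> C * x ^ Suc R" using \<open>C \<ge> 0\<close> x by simp
    with le show ?thesis by linarith
  qed
  finally show "norm (taylor_A \<alpha> x u) \<le> 3 * C * x ^ Suc R \<and> norm (taylor_B \<alpha> x u) \<le> 3 * C * x ^ Suc R"
    using A by (simp only: mult.assoc simp_thms)
qed

section \<open>Cauchy's inequality on a small circle around 0\<close>

lemma norm_laguerre_kernel_le:
  fixes w z :: complex
  assumes w: "norm w \<le> 1 / 2" and zw: "norm (z * w) \<le> b"
  shows "norm ((1 - w) powr (- (3 / 2)) * exp (- z * w / (1 - w))) \<le> exp (2 * pi) * 16 * exp (2 * b)"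
proof -
  have nw: "1 / 2 \<le> norm (1 - w)" "norm (1 - w) \<le> 2"
    using w norm_triangle_ineq2[of 1 w] norm_triangle_ineq4[of 1 w] by auto
  then have "norm ((1 - w) powr (- (3 / 2))) \<le> exp (real 2 * pi) * (2 / (1 / 2)) ^ 2"
    by (intro norm_powr_le) auto
  moreover have "norm (exp (- z * w / (1 - w))) \<le> exp (2 * b)"
  proof -
    have "norm (- z * w / (1 - w)) \<le> b / (1 / 2)"
      unfolding norm_divide using zw nw by (intro frac_le) (auto intro: order_trans[OF norm_ge_zero])
    then have "norm (- z * w / (1 - w)) \<le> 2 * b" by simp
    then show ?thesis using norm_exp order_trans exp_le_cancel_iff by metis
  qed
  ultimately show ?thesis
    unfolding norm_mult by (intro mult_mono) auto
qed

text \<open>As \<open>(1 - w) powr (- \<alpha> - 1)\<close> is \<open>f w\<close> times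
  \<open>(1 - w) powr (- (3 / 2))\<close>, replacing \<open>f\<close> by \<open>p\<close> changes
  the coefficient of \<open>w ^ n\<close> by that of \<open>h\<close>.\<close>

lemma laguerre_minus_saddle_coeff:
  fixes n :: nat and x :: real and \<alpha> :: complex and p :: "complex poly"
  defines "z \<equiv> of_nat n * of_real x"
  defines "h \<equiv> \<lambda>w::complex. ((1 - w) powr (1 / 2 - \<alpha>) - poly p w) *
    ((1 - w) powr (- (3 / 2)) * exp (- z * w / (1 - w)))"
  assumes r: "0 < r" "r \<le> 1 / 2" and B: "\<And>w. norm w = r \<Longrightarrow> norm (h w) \<le> B"
  shows "norm (laguerre (int n) \<alpha> z - saddle_coeff x n p) \<le> B / r ^ n"
proof -
  let ?E = "\<lambda>w. (1 - w) powr (- (3 / 2)) * exp (- z * w / (1 - w))"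
  have slit: "1 - w \<noteq> 0" "1 - w \<notin> \<real>\<^sub>\<le>\<^sub>0" if "norm w < 1" for w :: complex
    using that complex_Re_le_cmod[of w] by (auto simp: complex_nonpos_Reals_iff)
  have "eval_fps (fps_of_poly p) = poly p" by (simp add: fun_eq_iff)
  then have "(\<lambda>w. poly p w) has_fps_expansion fps_of_poly p"
    using eval_fps_has_fps_expansion[of "fps_of_poly p"] by simp
  then have p: "(\<lambda>w. poly p w * ?E w) has_fps_expansion fps_of_poly p * laguerre_fps (- (3 / 2)) z"
    by (intro fps_expansion_intros has_fps_expansion_laguerre)
  have "\<forall>\<^sub>F w in nhds 0. w \<in> ball (0::complex) 1"
    by (intro eventually_nhds_in_open) auto
  then have "\<forall>\<^sub>F w in nhds 0. (1 - w) powr (- \<alpha> - 1) * exp (- z * w / (1 - w)) - poly p w * ?E w = h w"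
  proof eventually_elim
    case (elim w)
    have "- \<alpha> - 1 = (1 / 2 - \<alpha>) + (- (3 / 2))" by simp
    then have "(1 - w) powr (- \<alpha> - 1) = (1 - w) powr (1 / 2 - \<alpha>) * (1 - w) powr (- (3 / 2))"
      by (simp only: powr_add)
    then show ?case by (simp add: h_def algebra_simps)
  qed
  from has_fps_expansion_cong[OF this refl]
  have "h has_fps_expansion laguerre_fps (- \<alpha> - 1) z - fps_of_poly p * laguerre_fps (- (3 / 2)) z"
    using has_fps_expansion_diff[OF has_fps_expansion_laguerre[of "- \<alpha> - 1" z] p] by simp
  from fps_nth_fps_expansion[OF this, of n]
  have eq: "laguerre (int n) \<alpha> z - saddle_coeff x n p = (deriv ^^ n) h 0 / fact n"
    by (simp add: saddle_coeff_def z_def laguerre_fps_def)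
  have "norm ((deriv ^^ n) h 0) \<le> fact n * B / r ^ n"
  proof (rule Cauchy_inequality)
    have "h holomorphic_on cball 0 r"
      unfolding h_def using slit r by (intro holomorphic_intros) auto
    then show "h holomorphic_on ball 0 r" "continuous_on (cball 0 r) h"
      by (auto intro: holomorphic_on_imp_continuous_on holomorphic_on_subset)
  qed (use r B in auto)
  then have "norm ((deriv ^^ n) h 0) / fact n \<le> fact n * B / r ^ n / fact n"
    by (rule divide_right_mono) simp
  then show ?thesis unfolding eq by (simp add: norm_divide)
qed

lemma partial_sum_eq_saddle_coeff:
  "(\<Sum>k<N. a k * Phi k x n + b k * Psi k x n) =
     saddle_coeff x n (\<Sum>k<N. smult (a k) (saddle_poly x ^ k) + smult (b k) (saddle_poly x ^ k * [:0, 1:]))"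
proof (induction N)
  case 0
  show ?case by (simp add: saddle_coeff_def)
next
  case (Suc N)
  then show ?case
    by (simp only: sum.lessThan_Suc saddle_coeff_add saddle_coeff_smult Phi_eq_saddle_coeff Psi_eq_saddle_coeff)
qed

text \<open>For fixed \<open>n\<close> the small radius costs only a power of \<open>x\<close>. The
  factor \<open>((1 + \<delta>) / x) ^ N\<close> is retained to compensate this growth for large
  \<open>x\<close>.\<close>

lemma laguerre_expansion_remainder:
  assumes \<delta>: "0 < \<delta>" "\<delta> \<le> 1"
  obtains C m \<kappa> where "C \<ge> 0" "0 < \<kappa>" "\<kappa> < 1"
    "\<And>x \<alpha> N. 1 + \<delta> \<le> x \<Longrightarrow> norm \<alpha> + 2 \<le> real R \<Longrightarrow>
      norm (laguerre (int n) \<alpha> (of_nat n * of_real x) -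
        (\<Sum>k<N. coeff_A \<alpha> x k * Phi k x n + coeff_B \<alpha> x k * Psi k x n))
      \<le> C * x ^ m * (\<kappa> * ((1 + \<delta>) / x)) ^ N"
proof -
  \<comment> \<open>For \<open>norm w = c / x\<close> the saddle polynomial is at most
    \<open>(1 + c)\<^sup>2 + c \<le> 1 + 4 c = \<mu>\<close> in modulus, while the Taylor estimates
    reach radius \<open>\<theta> x\<close>. As
    \<open>\<theta> (1 + \<delta>) = 1 + \<delta> / 2\<close>, the ratio of the radii is
    \<open>\<kappa> (1 + \<delta>) / x\<close>.\<close>
  define \<theta> where "\<theta> = (1 + \<delta> / 2) / (1 + \<delta>)"
  define \<kappa> where "\<kappa> = (1 + \<delta> / 4) / (1 + \<delta> / 2)"
  define c where "c = \<delta> / 16"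
  define \<mu> where "\<mu> = 1 + \<delta> / 4"
  have \<theta>: "0 < \<theta>" "\<theta> < 1" and \<kappa>: "0 < \<kappa>" "\<kappa> < 1" and c: "0 < c" "c \<le> 1 / 16"
    using \<delta> by (auto simp: \<theta>_def \<kappa>_def c_def)
  obtain M where M: "M \<ge> 0" "\<And>x \<alpha> u. 1 \<le> x \<Longrightarrow> norm \<alpha> + 2 \<le> real R \<Longrightarrow> norm u \<le> \<theta> * x \<Longrightarrow>
      norm (taylor_A \<alpha> x u) \<le> M * x ^ Suc R \<and> norm (taylor_B \<alpha> x u) \<le> M * x ^ Suc R"
    using taylor_bound[OF \<theta>] by blast
  define G where "G = exp (2 * pi) * 16 * exp (2 * real n)"
  have "G \<ge> 0" by (simp add: G_def)
  define C where "C = 2 * (M / (1 - \<kappa>)) * G / c ^ n"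
  show thesis
  proof
    show "C \<ge> 0" using M \<kappa> c by (simp add: C_def G_def)
    show "0 < \<kappa>" "\<kappa> < 1" by fact+
    fix x :: real and \<alpha> :: complex and N
    assume x: "1 + \<delta> \<le> x" and \<alpha>: "norm \<alpha> + 2 \<le> real R"
    have x1: "1 < x" using x \<delta> by simp
    define \<rho> where "\<rho> = \<theta> * x"
    define q where "q = \<kappa> * ((1 + \<delta>) / x)"
    have q: "\<mu> / \<rho> = q" using \<delta> x1
      by (simp add: \<mu>_def \<rho>_def q_def \<kappa>_def \<theta>_def divide_simps) (simp add: algebra_simps)
    have "(1 + \<delta>) / x \<le> 1" using x \<delta> by simp
    then have "q \<le> \<kappa>" unfolding q_def using \<kappa> by (intro mult_left_le) auto
    have "q \<ge> 0" using \<kappa> \<delta> x1 by (simp add: q_def)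
    have \<rho>: "0 < \<rho>" "\<rho> < x" using \<theta> x1 by (auto simp: \<rho>_def)
    have "\<mu> < \<rho>" using q \<rho> \<open>q \<le> \<kappa>\<close> \<kappa> by (simp add: divide_simps split: if_splits)
    define T where "T = M * x ^ Suc R * q ^ N / (1 - \<kappa>)"
    have tail: "norm (F u - (\<Sum>k<N. (deriv ^^ k) F 0 / fact k * u ^ k)) \<le> T"
      if "F \<in> {taylor_A \<alpha> x, taylor_B \<alpha> x}" and u: "norm u \<le> \<mu>" for F u
    proof -
      have "F holomorphic_on ball 0 x" using that taylor_holomorphic x1 by auto
      moreover have "norm (F v) \<le> M * x ^ Suc R" if "norm v \<le> \<rho>" for v
        using M(2)[of x \<alpha> v] x1 \<alpha> that \<open>F \<in> _\<close> by (auto simp: \<rho>_def)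
      ultimately have "norm (F u - (\<Sum>k<N. (deriv ^^ k) F 0 / fact k * u ^ k)) \<le>
          M * x ^ Suc R * (\<mu> / \<rho>) ^ N / (1 - \<mu> / \<rho>)"
        using \<rho> u \<open>\<mu> < \<rho>\<close> by (intro holomorphic_Taylor_remainder_bound) auto
      also have "\<dots> \<le> T"
        unfolding q T_def using \<open>q \<le> \<kappa>\<close> \<kappa> \<open>q \<ge> 0\<close> M x1 by (intro divide_left_mono) auto
      finally show ?thesis .
    qed
    have "T \<ge> 0" using M x1 \<kappa> \<open>q \<ge> 0\<close> by (simp add: T_def)
    define r where "r = c / x"
    have r: "0 < r" "r \<le> c" "x * r = c" using c x1 by (auto simp: r_def divide_le_eq)
    define p where "p = (\<Sum>k<N. smult (coeff_A \<alpha> x k) (saddle_poly x ^ k) +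
        smult (coeff_B \<alpha> x k) (saddle_poly x ^ k * [:0, 1:]))"
    have "norm (laguerre (int n) \<alpha> (of_nat n * of_real x) - saddle_coeff x n p) \<le> 2 * T * G / r ^ n"
    proof (rule laguerre_minus_saddle_coeff)
      fix w :: complex assume w: "norm w = r"
      define u where "u = (1 - w)\<^sup>2 + of_real x * w"
      have "norm u \<le> (norm (1 - w))\<^sup>2 + x * norm w"
        unfolding u_def using norm_triangle_ineq[of "(1 - w)\<^sup>2" "of_real x * w"] x1
        by (simp add: norm_mult norm_power)
      also have "\<dots> \<le> (1 + c)\<^sup>2 + c"
        using w r norm_triangle_ineq4[of 1 w] by (intro add_mono power_mono) auto
      also have "\<dots> \<le> 1 + 4 * c"
      proof -
        have "c * c \<le> c" using c by (intro mult_left_le) auto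
        then show ?thesis by (simp add: power2_eq_square algebra_simps)
      qed
      also have "\<dots> = \<mu>" by (simp add: \<mu>_def c_def)
      finally have u: "norm u \<le> \<mu>" .
      have "norm u < x" using u \<open>\<mu> < \<rho>\<close> \<rho> by linarith
      have "poly p w = (\<Sum>k<N. coeff_A \<alpha> x k * u ^ k) + (\<Sum>k<N. coeff_B \<alpha> x k * u ^ k) * w"
        by (simp add: p_def poly_sum poly_saddle_poly u_def sum.distrib sum_distrib_left mult_ac)
      then have "(1 - w) powr (1 / 2 - \<alpha>) - poly p w =
         (taylor_A \<alpha> x u - (\<Sum>k<N. coeff_A \<alpha> x k * u ^ k)) +
         (taylor_B \<alpha> x u - (\<Sum>k<N. coeff_B \<alpha> x k * u ^ k)) * w"
        using one_minus_powr_eq_taylor[of x w \<alpha>] \<open>norm u < x\<close> x1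
        by (simp add: u_def algebra_simps)
      also have "norm \<dots> \<le> T + T * 1"
      proof (rule norm_triangle_mono)
        have "x > 0" using x1 by simp
        show "norm (taylor_A \<alpha> x u - (\<Sum>k<N. coeff_A \<alpha> x k * u ^ k)) \<le> T"
          unfolding coeff_eq_taylor[OF \<open>x > 0\<close>] by (rule tail) (use u in auto)
        have "norm (taylor_B \<alpha> x u - (\<Sum>k<N. coeff_B \<alpha> x k * u ^ k)) \<le> T"
          unfolding coeff_eq_taylor[OF \<open>x > 0\<close>] by (rule tail) (use u in auto)
        moreover have "norm w \<le> 1" using w r c by linarith
        ultimately show "norm ((taylor_B \<alpha> x u - (\<Sum>k<N. coeff_B \<alpha> x k * u ^ k)) * w) \<le> T * 1"
          unfolding norm_mult using \<open>T \<ge> 0\<close> by (intro mult_mono) auto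
      qed
      finally have f: "norm ((1 - w) powr (1 / 2 - \<alpha>) - poly p w) \<le> 2 * T" by simp
      have "norm ((1 - w) powr (- (3 / 2)) * exp (- (of_nat n * of_real x) * w / (1 - w))) \<le> G"
        unfolding G_def
      proof (rule norm_laguerre_kernel_le)
        show "norm w \<le> 1 / 2" using w r c by simp
        \<comment> \<open>The radius \<open>c / x\<close> makes this independent of
          \<open>x\<close>, so the kernel is bounded uniformly in \<open>x\<close>.\<close>
        have "norm (of_nat n * of_real x * w) = real n * c"
          using w r x1 by (simp add: norm_mult mult.assoc)
        also have "\<dots> \<le> real n" using c by (simp add: mult_left_le)
        finally show "norm (of_nat n * of_real x * w) \<le> real n" .
      qed
      with f show "norm (((1 - w) powr (1 / 2 - \<alpha>) - poly p w) *
          ((1 - w) powr (- (3 / 2)) * exp (- (of_nat n * of_real x) * w / (1 - w)))) \<le> 2 * T * G"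
        unfolding norm_mult[of "_ - _"] using \<open>T \<ge> 0\<close> by (intro mult_mono) auto
    qed (use r c in auto)
    also have "2 * T * G / r ^ n = C * x ^ (Suc R + n) * q ^ N"
      by (simp add: T_def C_def r_def power_divide power_add mult_ac)
    finally show "norm (laguerre (int n) \<alpha> (of_nat n * of_real x) -
        (\<Sum>k<N. coeff_A \<alpha> x k * Phi k x n + coeff_B \<alpha> x k * Psi k x n))
      \<le> C * x ^ (Suc R + n) * (\<kappa> * ((1 + \<delta>) / x)) ^ N"
      unfolding partial_sum_eq_saddle_coeff p_def q_def .
  qed
qed

lemma laguerre_expansion_uniform:
  assumes K: "compact K" and \<delta>: "\<delta> > 0"
  shows "uniform_limit (K \<times> {1 + \<delta>..})
             (\<lambda>N (\<alpha>, x). \<Sum>k<N. coeff_A \<alpha> x k * Phi k x n + coeff_B \<alpha> x k * Psi k x n)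
             (\<lambda>(\<alpha>, x). laguerre (int n) \<alpha> (of_nat n * of_real x))
             sequentially"
proof (rule uniform_limitI)
  fix e :: real assume e: "e > 0"
  \<comment> \<open>The remainder estimate asks for \<open>\<delta> \<le> 1\<close>; shrinking
    \<open>\<delta>\<close> only enlarges the range of \<open>x\<close>.\<close>
  define \<delta>' where "\<delta>' = min \<delta> 1"
  have \<delta>': "0 < \<delta>'" "\<delta>' \<le> 1" "\<delta>' \<le> \<delta>" using \<delta> by (auto simp: \<delta>'_def)
  obtain b where b: "\<And>\<alpha>. \<alpha> \<in> K \<Longrightarrow> norm \<alpha> \<le> b"
    using compact_imp_bounded[OF K] by (auto simp: bounded_iff)
  define R where "R = nat \<lceil>b + 2\<rceil>"
  have R: "norm \<alpha> + 2 \<le> real R" if "\<alpha> \<in> K" for \<alpha>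
  proof -
    have "norm \<alpha> + 2 \<le> b + 2" using b[OF that] by simp
    also have "\<dots> \<le> real R" unfolding R_def by (rule real_nat_ceiling_ge)
    finally show ?thesis .
  qed
  obtain C m \<kappa> where C: "C \<ge> 0" "0 < \<kappa>" "\<kappa> < 1"
    "\<And>x \<alpha> N. 1 + \<delta>' \<le> x \<Longrightarrow> norm \<alpha> + 2 \<le> real R \<Longrightarrow>
      norm (laguerre (int n) \<alpha> (of_nat n * of_real x) -
        (\<Sum>k<N. coeff_A \<alpha> x k * Phi k x n + coeff_B \<alpha> x k * Psi k x n))
      \<le> C * x ^ m * (\<kappa> * ((1 + \<delta>') / x)) ^ N"
    by (rule laguerre_expansion_remainder[OF \<delta>'(1,2), of R n]) (rule that)
  have "(\<lambda>N. C * (1 + \<delta>') ^ m * \<kappa> ^ N) \<longlonglongrightarrow> C * (1 + \<delta>') ^ m * 0"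
    using C by (intro tendsto_intros LIMSEQ_realpow_zero) auto
  then have "\<forall>\<^sub>F N in sequentially. C * (1 + \<delta>') ^ m * \<kappa> ^ N < e"
    by (rule order_tendstoD(2)) (use e in simp)
  with eventually_ge_at_top[of m]
  show "\<forall>\<^sub>F N in sequentially. \<forall>y\<in>K \<times> {1 + \<delta>..}.
      dist ((\<lambda>(\<alpha>, x). \<Sum>k<N. coeff_A \<alpha> x k * Phi k x n + coeff_B \<alpha> x k * Psi k x n) y)
        ((\<lambda>(\<alpha>, x). laguerre (int n) \<alpha> (of_nat n * of_real x)) y) < e"
  proof eventually_elim
    case (elim N)
    have "dist (\<Sum>k<N. coeff_A \<alpha> x k * Phi k x n + coeff_B \<alpha> x k * Psi k x n)
        (laguerre (int n) \<alpha> (of_nat n * of_real x)) < e" if "\<alpha> \<in> K" "1 + \<delta> \<le> x" for \<alpha> x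
    proof -
      have x: "1 + \<delta>' \<le> x" using that \<delta>' by simp
      have "dist (\<Sum>k<N. coeff_A \<alpha> x k * Phi k x n + coeff_B \<alpha> x k * Psi k x n)
        (laguerre (int n) \<alpha> (of_nat n * of_real x)) \<le> C * x ^ m * (\<kappa> * ((1 + \<delta>') / x)) ^ N"
        using C(4)[OF x R[OF that(1)], of N] by (simp add: dist_norm norm_minus_commute)
      also have "\<dots> = C * \<kappa> ^ N * (x ^ m * ((1 + \<delta>') / x) ^ N)"
        by (simp only: power_mult_distrib mult_ac)
      \<comment> \<open>The base is at most 1, so for \<open>N \<ge> m\<close> the exponent drops to
        \<open>m\<close> and all powers of \<open>x\<close> cancel: hence uniformity on an unbounded
        range.\<close>
      also have "\<dots> \<le> C * \<kappa> ^ N * (x ^ m * ((1 + \<delta>') / x) ^ m)"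
        using C x \<delta>' elim by (intro mult_left_mono power_decreasing) auto
      also have "x ^ m * ((1 + \<delta>') / x) ^ m = (1 + \<delta>') ^ m"
        using x \<delta>' by (simp flip: power_mult_distrib)
      finally show ?thesis using elim by (simp add: mult_ac)
    qed
    then show ?case by auto
  qed
qed

lemma bigo_saddle_norm:
  assumes "\<And>n. norm (f n) \<le> saddle_norm x k n"
  shows "(\<lambda>n. norm (f n :: complex)) \<in>
    O(\<lambda>n. (norm (Phi 0 x n) + norm (Psi 0 x n)) / real n ^ ((k + 1) div 2))"
proof -
  obtain C where "\<forall>\<^sub>F n in sequentially.
      saddle_norm x k n \<le> C * (saddle_norm x 0 n / real n ^ ((k + 1) div 2))"
    using saddle_norm_asymp[of x k] by blast
  then have "\<forall>\<^sub>F n in sequentially. norm (norm (f n)) \<le>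
      C * norm ((norm (Phi 0 x n) + norm (Psi 0 x n)) / real n ^ ((k + 1) div 2))"
  proof eventually_elim
    case (elim n)
    have "norm (f n) \<le> C * (saddle_norm x 0 n / real n ^ ((k + 1) div 2))"
      using assms elim by (rule order_trans)
    then show ?case by (simp add: saddle_norm_def)
  qed
  then show ?thesis by (rule bigoI)
qed

theorem theorem4p1:
  shows
    "(\<forall>n::nat. n > 0 \<longrightarrow>
        (\<forall>(x::real) (\<alpha>::complex). x > 1 \<longrightarrow>
           (\<lambda>k. coeff_A \<alpha> x k * Phi k x n + coeff_B \<alpha> x k * Psi k x n)
             sums laguerre (int n) \<alpha> (of_nat n * of_real x)) \<and>
        (\<forall>(K::complex set) (\<delta>::real). compact K \<longrightarrow> \<delta> > 0 \<longrightarrow>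
           uniform_limit (K \<times> {1 + \<delta>..})
             (\<lambda>N (\<alpha>, x). \<Sum>k<N. coeff_A \<alpha> x k * Phi k x n + coeff_B \<alpha> x k * Psi k x n)
             (\<lambda>(\<alpha>, x). laguerre (int n) \<alpha> (of_nat n * of_real x))
             sequentially)) \<and>
     (\<forall>(x::real) (k::nat). x > 1 \<longrightarrow>
        (\<lambda>n. norm (Phi k x n)) \<in>
          O(\<lambda>n. (norm (Phi 0 x n) + norm (Psi 0 x n)) / real n ^ ((k + 1) div 2)) \<and>
        (\<lambda>n. norm (Psi k x n)) \<in>
          O(\<lambda>n. (norm (Phi 0 x n) + norm (Psi 0 x n)) / real n ^ ((k + 1) div 2)))"
proof (intro conjI allI impI)
  fix n :: nat and x :: real and \<alpha> :: complex assume "x > 1"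
  \<comment> \<open>With \<open>\<delta> = x - 1\<close> the point \<open>x\<close> is the left end
    of the range.\<close>
  then have "uniform_limit ({\<alpha>} \<times> {1 + (x - 1)..})
       (\<lambda>N (\<alpha>, x). \<Sum>k<N. coeff_A \<alpha> x k * Phi k x n + coeff_B \<alpha> x k * Psi k x n)
       (\<lambda>(\<alpha>, x). laguerre (int n) \<alpha> (of_nat n * of_real x)) sequentially"
    by (intro laguerre_expansion_uniform) auto
  from tendsto_uniform_limitI[OF this, of "(\<alpha>, x)"]
  show "(\<lambda>k. coeff_A \<alpha> x k * Phi k x n + coeff_B \<alpha> x k * Psi k x n)
      sums laguerre (int n) \<alpha> (of_nat n * of_real x)"
    by (simp add: sums_def)
next
  fix n :: nat and K :: "complex set" and \<delta> :: real assume "compact K" "\<delta> > 0"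
  then show "uniform_limit (K \<times> {1 + \<delta>..})
       (\<lambda>N (\<alpha>, x). \<Sum>k<N. coeff_A \<alpha> x k * Phi k x n + coeff_B \<alpha> x k * Psi k x n)
       (\<lambda>(\<alpha>, x). laguerre (int n) \<alpha> (of_nat n * of_real x)) sequentially"
    by (rule laguerre_expansion_uniform)
next
  fix x :: real and k :: nat
  show "(\<lambda>n. norm (Phi k x n)) \<in>
      O(\<lambda>n. (norm (Phi 0 x n) + norm (Psi 0 x n)) / real n ^ ((k + 1) div 2))"
    by (rule bigo_saddle_norm) (simp add: saddle_norm_def)
  show "(\<lambda>n. norm (Psi k x n)) \<in>
      O(\<lambda>n. (norm (Phi 0 x n) + norm (Psi 0 x n)) / real n ^ ((k + 1) div 2))"
    by (rule bigo_saddle_norm) (simp add: saddle_norm_def)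
qed

end
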